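(* Let $\epsilon>0$ and $A\ge 0$. There exists $n_0\ge 0$ such that for every composition $\lambda$ of size $n\ge n_0$ whose first run and last run both have length at most $A$, $$\sup_{(x,y)\in[0,1]^2}\big|d_{X_I,X_F}(x,y)-d_{X_I}(x)\,d_{X_F}(y)\big|<\epsilon,$$ where $d_{X_I,X_F}$ is the joint density of $(X_I,X_F)$ and $d_{X_I},d_{X_F}$ are the marginal densities, in the continuous model associated with $\lambda$.
   Context: A composition $\lambda$ of $n$ is a finite sequence of positive integers $(\lambda_1,\dots,\lambda_k)$ with $\sum_j\lambda_j=n$; its descent set is $D_\lambda=\{\lambda_1,\lambda_1+\lambda_2,\dots,\lambda_1+\dots+\lambda_{k-1}\}\subseteq\{1,\dots,n-1\}$. The continuous model associated with $\lambda$: let $P_\lambda=\{x\in[0,1]^n:\ x_i\ge x_{i+1}\text{ if }i\in D_\lambda,\ x_i\le x_{i+1}\text{ if }i\notin D_\lambda,\ 1\le i\le n-1\}$ and let $(x_1,\dots,x_n)$ be uniformly distributed on $P_\lambda$ (equivalently, independent uniform variables on $[0,1]$ conditioned on having the descent pattern $D_\lambda$); set $X_I=x_1$, $X_F=x_n$. A run of $\lambda$ is a maximal set of consecutive cells $\{a,a+1,\dots,b\}$ with $b\ge a+1$ such that either $\{a,\dots,b-1\}\cap D_\lambda=\emptyset$ or $\{a,\dots,b-1\}\subseteq D_\lambda$; its length is $b-a+1$. The first run is the run containing cell $1$, the last run the one containing cell $n$. (Via the correspondence $\sigma(i)=$ rank of $x_i$ among $x_1,\dots,x_n$, which gives the uniform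 permutation with descent set $D_\lambda$, this is equivalent to asymptotic independence of $\sigma_\lambda(1)/n$ and $\sigma_\lambda(n)/n$.) *)

theory Defs
  imports "HOL-Analysis.Analysis"
begin

definition is_composition :: "nat list \<Rightarrow> nat \<Rightarrow> bool" where
  "is_composition lam n \<longleftrightarrow> (\<forall>k\<in>set lam. 0 < k) \<and> sum_list lam = n"

definition descents :: "nat list \<Rightarrow> nat set" where
  "descents lam = {sum_list (take j lam) | j. 1 \<le> j \<and> j < length lam}"

definition monotone_seg :: "nat list \<Rightarrow> nat \<Rightarrow> nat \<Rightarrow> bool" where
  "monotone_seg lam a b \<longleftrightarrow>
     1 \<le> a \<and> a + 1 \<le> b \<and> b \<le> sum_list lam \<and>
     ({a..<b} \<inter> descents lam = {} \<or> {a..<b} \<subseteq> descents lam)"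

definition is_run :: "nat list \<Rightarrow> nat \<Rightarrow> nat \<Rightarrow> bool" where
  "is_run lam a b \<longleftrightarrow> monotone_seg lam a b \<and>
     (\<forall>a' b'. a' \<le> a \<and> b \<le> b' \<and> monotone_seg lam a' b' \<longrightarrow> a' = a \<and> b' = b)"

definition runs_at_le :: "nat list \<Rightarrow> nat \<Rightarrow> real \<Rightarrow> bool" where
  "runs_at_le lam c A \<longleftrightarrow> (\<forall>a b. is_run lam a b \<and> a \<le> c \<and> c \<le> b \<longrightarrow> real (b - a + 1) \<le> A)"

definition polytope :: "nat list \<Rightarrow> (nat \<Rightarrow> real) set" where
  "polytope lam = (let n = sum_list lam; D = descents lam in
     {x \<in> {1..n} \<rightarrow>\<^sub>E UNIV. (\<forall>i\<in>{1..n}. 0 \<le> x i \<and> x i \<le> 1) \<and>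
        (\<forall>i. 1 \<le> i \<and> i < n \<longrightarrow> (i \<in> D \<longrightarrow> x (i+1) \<le> x i) \<and> (i \<notin> D \<longrightarrow> x i \<le> x (i+1)))})"

definition vol_poly :: "nat list \<Rightarrow> real" where
  "vol_poly lam = measure (PiM {1..sum_list lam} (\<lambda>_. lborel)) (polytope lam)"

definition dens_joint :: "nat list \<Rightarrow> real \<Rightarrow> real \<Rightarrow> real" where
  "dens_joint lam x y = (let n = sum_list lam in
     measure (PiM {2..<n} (\<lambda>_. lborel))
       {z \<in> {2..<n} \<rightarrow>\<^sub>E UNIV.
          (\<lambda>i. if i = 1 then x else if i = n then y else if i \<in> {2..<n} then z i else undefined)
            \<in> polytope lam} / vol_poly lam)"

definition dens_first :: "nat list \<Rightarrow> real \<Rightarrow> real" where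
  "dens_first lam x = (let n = sum_list lam in
     measure (PiM {2..n} (\<lambda>_. lborel))
       {z \<in> {2..n} \<rightarrow>\<^sub>E UNIV.
          (\<lambda>i. if i = 1 then x else if i \<in> {2..n} then z i else undefined) \<in> polytope lam}
     / vol_poly lam)"

definition dens_last :: "nat list \<Rightarrow> real \<Rightarrow> real" where
  "dens_last lam y = (let n = sum_list lam in
     measure (PiM {1..<n} (\<lambda>_. lborel))
       {z \<in> {1..<n} \<rightarrow>\<^sub>E UNIV.
          (\<lambda>i. if i = n then y else if i \<in> {1..<n} then z i else undefined) \<in> polytope lam}
     / vol_poly lam)"

end

(*
  Integrating out the coordinates one at a time turns the joint density of (X_I, X_F) and the density
  of X_F into two trajectories p, q of the operators f -> int_0^y f (ascent) and f -> int_y^1 f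
  (descent), started from a point mass and from the constant 1.  Asymptotic independence means that
  p is asymptotically proportional to q.

  Take a run of k equal steps followed by an opposite step, and let h >= 0 be the state at its start,
  decreasing for an ascending run because the step before the run is a descent.  With V the k-fold
  primitive of h, V is homogeneous up to one degree: t^k V(v) <= V(tv) <= t^(k-1) V(v).  Hence the state
  after the run lies between V(1)/(k+1) and V(1)/k times 1 - y^k.  If m q <= p <= M q, this makes
  M - m at most (3/k) m after one such block, and every further block multiplies M - m by at most
  1/(k+1) while m increases.  A composition of large size with short end runs has either a long inner
  run or many disjoint blocks, so (M - m)/m is small.  The same estimates bound both marginal densities
  by the lengths of the end runs, which makes the error uniform.
*)
theory Submission
  imports Defs
begin

section \<open>Step operators, their trajectories, comparison and reflection\<close>

text \<open>Integrates out the earlier of two neighbouring coordinates when the later one is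
  \<open>y\<close>: across a descent (\<open>b\<close> true) the earlier one lies in [y,1].\<close>

definition step_op :: "bool \<Rightarrow> (real \<Rightarrow> real) \<Rightarrow> real \<Rightarrow> real" where
  "step_op b f y = (if b then integral {y..1} f else integral {0..y} f)"

text \<open>A relation rather than a recursive function, so that linear combinations and reflections
  of trajectories are again trajectories. State \<open>i + 1\<close> arises from state
  \<open>i\<close> by step \<open>i\<close>.\<close>

definition trajectory :: "nat set \<Rightarrow> nat \<Rightarrow> (nat \<Rightarrow> real \<Rightarrow> real) \<Rightarrow> bool" where
  "trajectory D s p \<longleftrightarrow> p s integrable_on {0..1} \<and>
     (\<forall>i\<ge>s. \<forall>y\<in>{0..1}. p (Suc i) y = step_op (i \<in> D) (p i) y)"

lemma integrable_on_sub01: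
  fixes f :: "real \<Rightarrow> real"
  assumes "f integrable_on {0..1}" "0 \<le> a" "b \<le> 1"
  shows "f integrable_on {a..b}"
  using assms by (auto intro: integrable_on_subinterval)

lemma continuous_on_step_op:
  assumes "f integrable_on {0..1}"
  shows "continuous_on {0..1} (step_op b f)"
  using indefinite_integral_continuous_1[OF assms] indefinite_integral_continuous_1'[OF assms]
  by (cases b) (simp_all add: step_op_def[abs_def])

lemma trajectory_integrable:
  assumes "trajectory D s p" "s \<le> i"
  shows "p i integrable_on {0..1}"
  using assms(2)
proof (induction i rule: dec_induct)
  case base
  then show ?case using assms(1) by (simp add: trajectory_def)
next
  case (step i)
  have "step_op (i \<in> D) (p i) integrable_on {0..1}"
    by (intro integrable_continuous_interval continuous_on_step_op step.IH)
  moreover have "p (Suc i) y = step_op (i \<in> D) (p i) y" if "y \<in> {0..1}" for y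
    using assms(1) step that by (simp add: trajectory_def)
  ultimately show ?case
    using integrable_cong by blast
qed

lemma trajectory_Suc:
  assumes "trajectory D s p" "s \<le> i" "y \<in> {0..1}"
  shows "p (Suc i) y = step_op (i \<in> D) (p i) y"
  using assms by (simp add: trajectory_def)

lemma trajectory_shift:
  assumes "trajectory D s p" "s \<le> i"
  shows "trajectory D i p"
  using assms trajectory_integrable[OF assms] by (simp add: trajectory_def)

lemma step_op_mono:
  assumes "f integrable_on {0..1}" "g integrable_on {0..1}" "\<And>x. x \<in> {0..1} \<Longrightarrow> f x \<le> g x"
    and "y \<in> {0..1}"
  shows "step_op b f y \<le> step_op b g y"
proof -
  have "integral {u..v} f \<le> integral {u..v} g" if "0 \<le> u" "v \<le> 1" for u v
    using that assms(3) integrable_on_sub01[OF assms(1) that] integrable_on_sub01[OF assms(2) that]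
    by (intro integral_le) auto
  then show ?thesis using assms(4) by (simp add: step_op_def)
qed

lemma step_op_nonneg:
  assumes "f integrable_on {0..1}" "\<And>x. x \<in> {0..1} \<Longrightarrow> 0 \<le> f x" "y \<in> {0..1}"
  shows "0 \<le> step_op b f y"
  using step_op_mono[OF integrable_0 assms(1), of y b] assms(2,3)
  by (simp add: step_op_def split: if_splits)

text \<open>Integration is linear. This turns comparisons of two trajectories into nonnegativity of
  a third.\<close>

lemma trajectory_lincomb:
  assumes p: "trajectory D s p" and q: "trajectory D s q"
  shows "trajectory D s (\<lambda>i y. a * p i y + b * q i y)"
  unfolding trajectory_def
proof (intro conjI allI impI ballI)
  have p': "p i integrable_on {0..1}" and q': "q i integrable_on {0..1}" if "s \<le> i" for i
    using trajectory_integrable[OF p that] trajectory_integrable[OF q that] by auto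
  show "(\<lambda>y. a * p s y + b * q s y) integrable_on {0..1}"
    using p'[of s] q'[of s] by (intro integrable_add integrable_on_mult_right) auto
next
  fix i and y :: real assume i: "s \<le> i" and y: "y \<in> {0..1}"
  have int: "p i integrable_on {0..1}" "q i integrable_on {0..1}"
    using trajectory_integrable[OF p i] trajectory_integrable[OF q i] by auto
  have *: "integral {u..v} (\<lambda>y. a * p i y + b * q i y)
      = a * integral {u..v} (p i) + b * integral {u..v} (q i)" if "0 \<le> u" "v \<le> 1" for u v
    using integrable_on_sub01[OF int(1) that] integrable_on_sub01[OF int(2) that]
    by (subst integral_add) (auto intro!: integrable_on_mult_right)
  show "a * p (Suc i) y + b * q (Suc i) y = step_op (i \<in> D) (\<lambda>y. a * p i y + b * q i y) y"
    unfolding trajectory_Suc[OF p i y] trajectory_Suc[OF q i y] using y by (simp add: step_op_def *)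
qed

lemma trajectory_nonneg:
  assumes p: "trajectory D s p" and s: "s \<le> i" and nn: "\<And>y. y \<in> {0..1} \<Longrightarrow> 0 \<le> p i y"
    and "i \<le> j" "y \<in> {0..1}"
  shows "0 \<le> p j y"
  using assms(4,5)
proof (induction j arbitrary: y rule: dec_induct)
  case base
  then show ?case using nn by simp
next
  case (step j)
  have "s \<le> j" using s step by simp
  then show ?case
    unfolding trajectory_Suc[OF p \<open>s \<le> j\<close> step.prems]
    by (intro step_op_nonneg step.IH step.prems trajectory_integrable[OF p])
qed

text \<open>The difference \<open>b * q - a * p\<close> is a trajectory that is nonnegative at
  \<open>i\<close>, and the steps preserve nonnegativity.\<close>

lemma trajectory_le:
  assumes p: "trajectory D s p" and q: "trajectory D s q" and s: "s \<le> i"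
    and le: "\<And>y. y \<in> {0..1} \<Longrightarrow> a * p i y \<le> b * q i y"
    and "i \<le> j" "y \<in> {0..1}"
  shows "a * p j y \<le> b * q j y"
  using trajectory_nonneg[OF trajectory_lincomb[OF p q, of "-a" b] s _ assms(5,6)] le by simp

lemma integral_reflect01:
  fixes f :: "real \<Rightarrow> real"
  assumes "f integrable_on {0..1}" "0 \<le> a" "a \<le> b" "b \<le> 1"
  shows "((\<lambda>x. f (1 - x)) has_integral (integral {1-b..1-a} f)) {a..b}"
proof -
  have "(f has_integral (integral {1-b..1-a} f)) (cbox (1-b) (1-a))"
    using integrable_on_sub01[OF assms(1), of "1-b" "1-a"] assms by auto
  from has_integral_affinity[OF this, of "-1" 1]
  have "((\<lambda>x. f (1 - x)) has_integral (integral {1-b..1-a} f)) ((\<lambda>x. 1 - x) ` {1-b..1-a})"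
    by simp
  moreover have "(\<lambda>x. 1 - x) ` {1-b..1-a} = {a..b}"
    by (auto simp: image_iff intro!: bexI[of _ "1 - x" for x])
  ultimately show ?thesis by simp
qed

text \<open>Substituting 1 - y exchanges the two kinds of step. Estimates can therefore be proved
  for one orientation and transferred to the other.\<close>

lemma trajectory_reflect:
  assumes p: "trajectory D s p"
  shows "trajectory (- D) s (\<lambda>i y. p i (1 - y))"
  unfolding trajectory_def
proof (intro conjI allI impI ballI)
  show "(\<lambda>y. p s (1 - y)) integrable_on {0..1}"
    using integral_reflect01[OF trajectory_integrable[OF p order_refl], of 0 1] by auto
next
  fix i and y :: real assume i: "s \<le> i" and y: "y \<in> {0..1}"
  have y': "1 - y \<in> {0..1}" using y by auto
  show "p (Suc i) (1 - y) = step_op (i \<in> - D) (\<lambda>y. p i (1 - y)) y"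
    unfolding trajectory_Suc[OF p i y']
    using y integral_unique[OF integral_reflect01[OF trajectory_integrable[OF p i], of 0 y]]
      integral_unique[OF integral_reflect01[OF trajectory_integrable[OF p i], of y 1]]
    by (auto simp: step_op_def)
qed

section \<open>Runs of equal steps\<close>

lemma integral_scale:
  fixes f :: "real \<Rightarrow> real"
  assumes f: "f integrable_on {0..1}" and t: "t \<in> {0..1}" and v: "v \<in> {0..1}"
  shows "integral {0..t * v} f = t * integral {0..v} (\<lambda>w. f (t * w))"
    and "t > 0 \<Longrightarrow> (\<lambda>w. f (t * w)) integrable_on {0..v}"
proof -
  have *: "((\<lambda>w. f (t * w)) has_integral (1/t) * integral {0..t * v} f) {0..v}" if "t > 0"
  proof -
    have "t * v \<le> 1" using t v by (simp add: mult_le_one)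
    then have "(f has_integral integral {0..t * v} f) {0..t * v}"
      using integrable_on_sub01[OF f] by auto
    from has_integral_stretch_real[OF this, of t] that
    show ?thesis by (simp add: image_divide_atLeastAtMost)
  qed
  show "integral {0..t * v} f = t * integral {0..v} (\<lambda>w. f (t * w))"
    using integral_unique[OF *] t by (cases "t = 0") auto
  show "t > 0 \<Longrightarrow> (\<lambda>w. f (t * w)) integrable_on {0..v}" using * by blast
qed

text \<open>The pointwise factor \<open>c\<close> survives integration and the change of variables
  contributes a factor \<open>t\<close>. Iterated along a run, this produces the powers of
  \<open>t\<close> below.\<close>

lemma integral_scale_le:
  fixes f :: "real \<Rightarrow> real"
  assumes f: "f integrable_on {0..1}" and t: "t \<in> {0..1}" and v: "v \<in> {0..1}"
    and le: "\<And>w. w \<in> {0..v} \<Longrightarrow> f (t * w) \<le> c * f w"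
  shows "integral {0..t * v} f \<le> t * c * integral {0..v} f"
proof (cases "t = 0")
  case False
  then have "t > 0" using t by simp
  have "integral {0..v} (\<lambda>w. f (t * w)) \<le> integral {0..v} (\<lambda>w. c * f w)"
    using integral_scale(2)[OF f t v \<open>t > 0\<close>] integrable_on_sub01[OF f, of 0 v] v le
    by (intro integral_le integrable_on_mult_right) auto
  then show ?thesis
    unfolding integral_scale(1)[OF f t v] using \<open>t > 0\<close> by simp
qed simp

lemma integral_scale_ge:
  fixes f :: "real \<Rightarrow> real"
  assumes f: "f integrable_on {0..1}" and t: "t \<in> {0..1}" and v: "v \<in> {0..1}"
    and ge: "\<And>w. w \<in> {0..v} \<Longrightarrow> c * f w \<le> f (t * w)"
  shows "t * c * integral {0..v} f \<le> integral {0..t * v} f"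
proof -
  have "(\<lambda>x. - f x) integrable_on {0..1}" using f by (rule integrable_neg)
  from integral_scale_le[OF this t v, of c] ge show ?thesis by simp
qed

text \<open>The first ascent turns a nonnegative state into a nondecreasing one, which is the bound
  with exponent 0; each of the other \<open>k\<close> ascents adds a factor
  \<open>t\<close>.\<close>

lemma up_run_scale_le:
  assumes p: "trajectory D a p" and nn: "\<And>y. y \<in> {0..1} \<Longrightarrow> 0 \<le> p a y"
    and up: "\<And>i. a \<le> i \<Longrightarrow> i < a + Suc k \<Longrightarrow> i \<notin> D"
    and t: "t \<in> {0..1}" and v: "v \<in> {0..1}"
  shows "p (a + Suc k) (t * v) \<le> t ^ k * p (a + Suc k) v"
  using up v
proof (induction k arbitrary: v)
  case 0
  have tv: "t * v \<in> {0..1}" using t 0 by (auto intro: mult_le_one)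
  have "integral {0..t * v} (p a) \<le> integral {0..v} (p a)"
    using 0 t nn integrable_on_sub01[OF trajectory_integrable[OF p order_refl]]
      tv mult_left_le_one_le[of v t]
    by (intro integral_subset_le) auto
  then show ?case
    using trajectory_Suc[OF p order_refl] 0 tv by (auto simp: step_op_def)
next
  case (Suc k)
  have tv: "t * v \<in> {0..1}" using t Suc by (auto intro: mult_le_one)
  have nD: "a + Suc k \<notin> D" using Suc by simp
  have "p (a + Suc k) (t * w) \<le> t ^ k * p (a + Suc k) w" if "w \<in> {0..v}" for w
    using Suc.prems that by (intro Suc.IH) auto
  from integral_scale_le[OF trajectory_integrable[OF p] t Suc.prems(2) this]
  have "integral {0..t * v} (p (a + Suc k)) \<le> t * t ^ k * integral {0..v} (p (a + Suc k))" by simp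
  then show ?case
    using trajectory_Suc[OF p, of "a + Suc k"] nD Suc.prems(2) tv by (simp add: step_op_def)
qed

text \<open>A decreasing start is the bound with exponent 0 before any step, so \<open>k\<close>
  ascents give exponent \<open>k\<close>, one more than in the upper bound for equally many
  steps.\<close>

lemma up_run_scale_ge:
  assumes p: "trajectory D a p" and anti: "antimono_on {0..1} (p a)"
    and up: "\<And>i. a \<le> i \<Longrightarrow> i < a + k \<Longrightarrow> i \<notin> D"
    and t: "t \<in> {0..1}" and v: "v \<in> {0..1}"
  shows "t ^ k * p (a + k) v \<le> p (a + k) (t * v)"
  using up v
proof (induction k arbitrary: v)
  case 0
  then show ?case
    using monotone_onD[OF anti, of "t * v" v] t mult_left_le_one_le[of v t] by auto
next
  case (Suc k)
  have tv: "t * v \<in> {0..1}" using t Suc by (auto intro: mult_le_one)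
  have nD: "a + k \<notin> D" using Suc by simp
  have "t ^ k * p (a + k) w \<le> p (a + k) (t * w)" if "w \<in> {0..v}" for w
    using Suc.prems that by (intro Suc.IH) auto
  from integral_scale_ge[OF trajectory_integrable[OF p] t Suc.prems(2) this]
  have "t * t ^ k * integral {0..v} (p (a + k)) \<le> integral {0..t * v} (p (a + k))" by simp
  then show ?case
    using trajectory_Suc[OF p, of "a + k"] nD Suc.prems(2) tv by (simp add: step_op_def)
qed

lemma integral_power_interval:
  fixes a b :: real
  assumes "a \<le> b"
  shows "((\<lambda>t. t ^ k) has_integral (b ^ Suc k - a ^ Suc k) / Suc k) {a..b}"
proof -
  have "((\<lambda>t. t ^ k) has_integral (b ^ Suc k / Suc k - a ^ Suc k / Suc k)) {a..b}"
    by (rule fundamental_theorem_of_calculus[OF assms])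
       (auto simp flip: has_real_derivative_iff_has_vector_derivative
             intro!: derivative_eq_intros simp del: of_nat_Suc power_Suc)
  then show ?thesis by (simp add: diff_divide_distrib)
qed

text \<open>The lower homogeneity bound V(t) >= t^k V(1) for V = \<open>p (a + k)\<close> is
  integrated over the unit interval.\<close>

lemma up_run_integral_ge:
  assumes p: "trajectory D a p" and anti: "antimono_on {0..1} (p a)"
    and up: "\<And>i. a \<le> i \<Longrightarrow> i < a + k \<Longrightarrow> i \<notin> D"
  shows "p (a + k) 1 / Suc k \<le> integral {0..1} (p (a + k))"
proof -
  have ge: "t ^ k * p (a + k) 1 \<le> p (a + k) t" if "t \<in> {0..1}" for t
    using up_run_scale_ge[of D a p k t 1, OF p anti up that] by simp
  have "integral {0..1} (\<lambda>t. t ^ k * p (a + k) 1) \<le> integral {0..1} (p (a + k))"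
    using trajectory_integrable[OF p, of "a + k"] ge integral_power_interval[of 0 1 k]
    by (intro integral_le integrable_on_mult_left) auto
  then show ?thesis
    using integral_unique[OF integral_power_interval[of 0 1 k]] by simp
qed

text \<open>Upper bound: V(t) <= t^(k-1) V(1) is integrated over [y,1]. Lower bound: the same
  homogeneity leaves at most the fraction y^k of the total integral on [0,y], and that total is at
  least V(1)/(k+1).\<close>

lemma up_run_down_bounds:
  assumes p: "trajectory D a p" and nn: "\<And>y. y \<in> {0..1} \<Longrightarrow> 0 \<le> p a y"
    and anti: "antimono_on {0..1} (p a)"
    and up: "\<And>i. a \<le> i \<Longrightarrow> i < a + k \<Longrightarrow> i \<notin> D" and k: "k \<ge> 1" and down: "a + k \<in> D"
    and y: "y \<in> {0..1}"
  shows "p (Suc (a + k)) y \<le> p (a + k) 1 / k * (1 - y ^ k)"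
    and "p (a + k) 1 / Suc k * (1 - y ^ k) \<le> p (Suc (a + k)) y"
proof -
  obtain l where l: "k = Suc l" using k by (cases k) auto
  have int: "p (a + k) integrable_on {0..1}" using trajectory_integrable[OF p] by simp
  have E: "p (Suc (a + k)) y = integral {y..1} (p (a + k))"
    using trajectory_Suc[OF p _ y, of "a + k"] down by (simp add: step_op_def)
  have le: "p (a + k) (t * v) \<le> t ^ l * p (a + k) v" if "t \<in> {0..1}" "v \<in> {0..1}" for t v
    using up_run_scale_le[OF p nn, of l t v] up that by (simp add: l)
  have ipow: "((\<lambda>t. t ^ l) has_integral (1 - y ^ k) / k) {y..1}"
    using integral_power_interval[of y 1 l] y by (simp add: l)
  have "integral {y..1} (p (a + k)) \<le> integral {y..1} (\<lambda>t. t ^ l * p (a + k) 1)"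
    using y integrable_on_sub01[OF int, of y 1] ipow le[of _ 1]
    by (intro integral_le integrable_on_mult_left) auto
  also have "\<dots> = p (a + k) 1 / k * (1 - y ^ k)"
    using integral_unique[OF ipow] by simp
  finally show "p (Suc (a + k)) y \<le> p (a + k) 1 / k * (1 - y ^ k)" using E by simp
  have "integral {0..y * 1} (p (a + k)) \<le> y * y ^ l * integral {0..1} (p (a + k))"
    by (rule integral_scale_le[OF int y]) (use y le in auto)
  moreover have "integral {0..y} (p (a + k)) + integral {y..1} (p (a + k)) = integral {0..1} (p (a + k))"
    using y int by (intro Henstock_Kurzweil_Integration.integral_combine) auto
  ultimately have "(1 - y ^ k) * integral {0..1} (p (a + k)) \<le> integral {y..1} (p (a + k))"
    by (simp add: l algebra_simps)
  moreover have "(1 - y ^ k) * (p (a + k) 1 / Suc k) \<le> (1 - y ^ k) * integral {0..1} (p (a + k))"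
    using y up_run_integral_ge[of D a p k, OF p anti up] by (intro mult_left_mono) (auto simp: power_le_one)
  ultimately show "p (a + k) 1 / Suc k * (1 - y ^ k) \<le> p (Suc (a + k)) y"
    using E by (simp add: mult.commute)
qed

section \<open>Blocks and contraction of the ratio\<close>

text \<open>Step \<open>i\<close> compares cells \<open>i\<close> and \<open>i + 1\<close>, so a
  sign change at \<open>i\<close> makes cell \<open>i + 1\<close> a peak or a valley.\<close>

definition sign_change :: "nat set \<Rightarrow> nat \<Rightarrow> bool" where
  "sign_change D i \<longleftrightarrow> (i \<in> D) \<noteq> (Suc i \<in> D)"

text \<open>The \<open>v - u\<close> equal steps \<open>u + 1\<close>, ..., \<open>v\<close>,
  preceded by the opposite step \<open>u\<close> and followed by the opposite step
  \<open>v + 1\<close>. The run thus starts at state \<open>u + 1\<close>, and the closing step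
  produces state \<open>v + 2\<close>.\<close>

definition block :: "nat set \<Rightarrow> nat \<Rightarrow> nat \<Rightarrow> bool" where
  "block D u v \<longleftrightarrow> u < v \<and> sign_change D u \<and> sign_change D v \<and> (\<forall>i\<in>{u<..<v}. \<not> sign_change D i)"

lemma no_sign_change_const:
  assumes "\<And>i. a \<le> i \<Longrightarrow> i < b \<Longrightarrow> \<not> sign_change D i" "a \<le> i" "i \<le> b"
  shows "i \<in> D \<longleftrightarrow> a \<in> D"
  using assms(2,3)
proof (induction i rule: dec_induct)
  case (step i)
  then show ?case using assms(1)[of i] by (simp add: sign_change_def)
qed simp

lemma sign_change_Compl: "sign_change (- D) i = sign_change D i"
  by (auto simp: sign_change_def)

lemma block_Compl: "block (- D) u v = block D u v"
  by (simp add: block_def sign_change_Compl)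

text \<open>The direction of monotonicity that a step of kind \<open>b\<close> gives to its result:
  decreasing after a descent.\<close>

definition monotone_dir :: "bool \<Rightarrow> (real \<Rightarrow> real) \<Rightarrow> bool" where
  "monotone_dir b f \<longleftrightarrow> (if b then antimono_on {0..1} f else mono_on {0..1} f)"

lemma monotone_dir_step_op:
  assumes f: "f integrable_on {0..1}" and nn: "\<And>x. x \<in> {0..1} \<Longrightarrow> 0 \<le> f x"
  shows "monotone_dir b (step_op b f)"
proof -
  have "integral {u..v} f \<le> integral {u'..v'} f" if "0 \<le> u'" "u' \<le> u" "v \<le> v'" "v' \<le> 1" for u v u' v'
  proof (rule integral_subset_le)
    show "f integrable_on {u..v}" "f integrable_on {u'..v'}"
      using that by (auto intro: integrable_on_sub01[OF f])
  qed (use that nn in auto)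
  then show ?thesis
    by (auto simp: monotone_dir_def step_op_def monotone_on_def)
qed

lemma monotone_dir_trajectory:
  assumes p: "trajectory D s p" and "s \<le> i" and nn: "\<And>x. x \<in> {0..1} \<Longrightarrow> 0 \<le> p i x"
  shows "monotone_dir (i \<in> D) (p (Suc i))"
  using monotone_dir_step_op[OF trajectory_integrable[OF p assms(2)] nn, of "i \<in> D"]
    trajectory_Suc[OF p assms(2)]
  by (auto simp: monotone_dir_def monotone_on_def)

text \<open>Through a block the transition kernel is close to rank one: both the profile \<open>g\<close> and the
  evaluation point \<open>e\<close> are independent of the trajectory.\<close>

lemma block_rank_one:
  assumes bl: "block D u v"
  shows "\<exists>e\<in>{0..1}. \<exists>g.
    (\<forall>p. trajectory D (Suc u) p \<longrightarrow> (\<forall>y\<in>{0..1}. 0 \<le> p (Suc u) y) \<longrightarrow> monotone_dir (u \<in> D) (p (Suc u)) \<longrightarrow>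
      (\<forall>y\<in>{0..1}. p (Suc (Suc v)) y \<le> p (Suc v) e / real (v - u) * g y \<and>
         p (Suc v) e / real (Suc (v - u)) * g y \<le> p (Suc (Suc v)) y))"
proof -
  have down: "\<forall>y\<in>{0..1}. p (Suc (Suc v)) y \<le> p (Suc v) 1 / real (v - u) * (1 - y ^ (v - u)) \<and>
         p (Suc v) 1 / real (Suc (v - u)) * (1 - y ^ (v - u)) \<le> p (Suc (Suc v)) y"
    if bl: "block D u v" and u: "u \<in> D" and p: "trajectory D (Suc u) p"
      and nn: "\<And>y. y \<in> {0..1} \<Longrightarrow> 0 \<le> p (Suc u) y" and anti: "antimono_on {0..1} (p (Suc u))" for D p
  proof -
    have uv: "u < v" using bl by (simp add: block_def)
    have up: "i \<notin> D" if "Suc u \<le> i" "i < Suc u + (v - u)" for i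
      using no_sign_change_const[of "Suc u" v D i] bl u that by (auto simp: block_def sign_change_def)
    have d: "Suc u + (v - u) \<in> D"
      using bl up[of v] uv by (auto simp: block_def sign_change_def)
    show ?thesis
      using up_run_down_bounds[of D "Suc u" p "v - u", OF p nn anti up _ d] uv by auto
  qed
  show ?thesis
  proof (cases "u \<in> D")
    case True
    show ?thesis
      by (rule bexI[of _ 1], rule exI[of _ "\<lambda>y. 1 - y ^ (v - u)"])
         (use down[OF bl True] True in \<open>auto simp: monotone_dir_def\<close>)
  next
    case False
    \<comment> \<open>A descending run is mirrored into an ascending one, which moves the evaluation
      point from 1 to 0.\<close>
    have *: "p (Suc (Suc v)) y \<le> p (Suc v) 0 / real (v - u) * (1 - (1 - y) ^ (v - u)) \<and>
         p (Suc v) 0 / real (Suc (v - u)) * (1 - (1 - y) ^ (v - u)) \<le> p (Suc (Suc v)) y"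
      if p: "trajectory D (Suc u) p" and nn: "\<forall>y\<in>{0..1}. 0 \<le> p (Suc u) y"
        and m: "mono_on {0..1} (p (Suc u))" and y: "y \<in> {0..1}" for p y
    proof -
      have "antimono_on {0..1} (\<lambda>y. p (Suc u) (1 - y))"
        using m by (auto simp: monotone_on_def)
      moreover have "0 \<le> p (Suc u) (1 - y)" if "y \<in> {0..1}" for y
        using nn that by simp
      ultimately have "\<forall>y\<in>{0..1}. p (Suc (Suc v)) (1 - y) \<le> p (Suc v) (1 - 1) / real (v - u) * (1 - y ^ (v - u)) \<and>
         p (Suc v) (1 - 1) / real (Suc (v - u)) * (1 - y ^ (v - u)) \<le> p (Suc (Suc v)) (1 - y)"
        using bl False by (intro down[OF _ _ trajectory_reflect[OF p]]) (auto simp: block_Compl)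
      from bspec[OF this, of "1 - y"] y show ?thesis by simp
    qed
    show ?thesis
      by (rule bexI[of _ 0], rule exI[of _ "\<lambda>y. 1 - (1 - y) ^ (v - u)"])
         (use * False in \<open>auto simp: monotone_dir_def\<close>)
  qed
qed

text \<open>\<open>m\<close> and \<open>M\<close> enclose the quotient of \<open>p i\<close> by
  \<open>q i\<close>, written as products because \<open>q i\<close> may vanish at points. The gap
  is measured relative to \<open>m\<close>, so rescaling \<open>p\<close> by a positive factor does
  not affect it.\<close>

definition ratio_osc :: "(nat \<Rightarrow> real \<Rightarrow> real) \<Rightarrow> (nat \<Rightarrow> real \<Rightarrow> real) \<Rightarrow> real \<Rightarrow> nat \<Rightarrow> bool" where
  "ratio_osc p q \<tau> i \<longleftrightarrow>
     (\<exists>m M. 0 \<le> m \<and> M - m \<le> \<tau> * m \<and> (\<forall>y\<in>{0..1}. m * q i y \<le> p i y \<and> p i y \<le> M * q i y))"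

text \<open>The enclosing \<open>m\<close> and \<open>M\<close> stay valid under later steps, since
  these preserve inequalities.\<close>

lemma ratio_osc_le:
  assumes p: "trajectory D s p" and q: "trajectory D s q" and "s \<le> i" "ratio_osc p q \<tau> i" "i \<le> j" "\<tau> \<le> \<tau>'"
  shows "ratio_osc p q \<tau>' j"
proof -
  obtain m M where m: "0 \<le> m" "M - m \<le> \<tau> * m" "\<And>y. y \<in> {0..1} \<Longrightarrow> m * q i y \<le> p i y \<and> p i y \<le> M * q i y"
    using assms(4) by (auto simp: ratio_osc_def)
  have "m * q j y \<le> p j y \<and> p j y \<le> M * q j y" if "y \<in> {0..1}" for y
    using trajectory_le[OF q p assms(3) _ assms(5) that, of m 1]
      trajectory_le[OF p q assms(3) _ assms(5) that, of 1 M] m(3) by simp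
  moreover have "M - m \<le> \<tau>' * m"
    using m mult_right_mono[OF assms(6) m(1)] by linarith
  ultimately show ?thesis using m(1) unfolding ratio_osc_def by blast
qed

text \<open>Both trajectories leave the block enclosed by multiples of the same profile
  \<open>g\<close>, so their quotient is known up to the factors by which the two enclosures are
  off. This starts the comparison of \<open>p\<close> with \<open>q\<close>.\<close>

lemma ratio_osc_block_initial:
  assumes bl: "block D u v" and p: "trajectory D (Suc u) p" and q: "trajectory D (Suc u) q"
    and nn: "\<And>y. y \<in> {0..1} \<Longrightarrow> 0 \<le> p (Suc u) y" "\<And>y. y \<in> {0..1} \<Longrightarrow> 0 \<le> q (Suc u) y"
    and mono: "monotone_dir (u \<in> D) (p (Suc u))" "monotone_dir (u \<in> D) (q (Suc u))"
    and nz: "\<exists>y\<in>{0..1}. q (Suc (Suc v)) y \<noteq> 0"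
  shows "ratio_osc p q (3 / real (v - u)) (Suc (Suc v))"
proof -
  obtain e g where e: "e \<in> {0..1}"
    and R: "\<And>p y. \<lbrakk>trajectory D (Suc u) p; \<forall>y\<in>{0..1}. 0 \<le> p (Suc u) y; monotone_dir (u \<in> D) (p (Suc u)); y \<in> {0..1}\<rbrakk> \<Longrightarrow>
       p (Suc (Suc v)) y \<le> p (Suc v) e / real (v - u) * g y \<and>
         p (Suc v) e / real (Suc (v - u)) * g y \<le> p (Suc (Suc v)) y"
    using block_rank_one[OF bl] by blast
  have uv: "u < v" using bl by (simp add: block_def)
  define k where "k = real (v - u)"
  have k: "k \<ge> 1" and k1: "real (Suc (v - u)) = k + 1" using uv by (auto simp: k_def)
  define P Q where "P = p (Suc v) e" and "Q = q (Suc v) e"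
  have P: "0 \<le> P" and Q0: "0 \<le> Q"
    using trajectory_nonneg[OF p order_refl nn(1) _ e, of "Suc v"]
      trajectory_nonneg[OF q order_refl nn(2) _ e, of "Suc v"] uv by (auto simp: P_def Q_def)
  have Rp: "p (Suc (Suc v)) y \<le> P / k * g y" "P / (k+1) * g y \<le> p (Suc (Suc v)) y"
   and Rq: "q (Suc (Suc v)) y \<le> Q / k * g y" "Q / (k+1) * g y \<le> q (Suc (Suc v)) y" if "y \<in> {0..1}" for y
    using R[OF p _ mono(1) that] R[OF q _ mono(2) that] nn that
    by (auto simp: P_def Q_def k_def[symmetric] k1 simp del: of_nat_Suc)
  have "Q \<noteq> 0"
  proof
    assume "Q = 0"
    then have "q (Suc (Suc v)) y = 0" if "y \<in> {0..1}" for y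
      using Rq[OF that] by simp
    then show False using nz by simp
  qed
  then have Q: "Q > 0" using Q0 by simp
  \<comment> \<open>Lower bound of \<open>p\<close> over upper bound of \<open>q\<close>, and upper
    bound of \<open>p\<close> over lower bound of \<open>q\<close>.\<close>
  define m M where "m = P * k / ((k+1) * Q)" and "M = P * (k+1) / (k * Q)"
  have "0 \<le> m" using P Q k by (simp add: m_def)
  moreover have "M - m \<le> 3 / k * m"
  proof -
    have "M - m = P / Q * ((2 * k + 1) / (k * (k+1)))"
    proof -
      have "M - m = P / Q * ((k+1) / k - k / (k+1))"
        by (simp add: m_def M_def right_diff_distrib mult.commute)
      also have "(k+1) / k - k / (k+1) = (2 * k + 1) / (k * (k+1))"
        using k by (simp add: field_simps)
      finally show ?thesis .
    qed
    \<comment> \<open>Since \<open>k\<close> is at least 1, 2k + 1 <= 3k.\<close>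
    also have "\<dots> \<le> P / Q * (3 * k / (k * (k+1)))"
      using k P Q by (intro mult_left_mono divide_right_mono) auto
    also have "\<dots> = 3 / k * m" using k Q by (simp add: m_def mult.commute)
    finally show ?thesis .
  qed
  moreover have "m * q (Suc (Suc v)) y \<le> p (Suc (Suc v)) y \<and> p (Suc (Suc v)) y \<le> M * q (Suc (Suc v)) y"
    if y: "y \<in> {0..1}" for y
  proof
    have "m * q (Suc (Suc v)) y \<le> m * (Q / k * g y)"
      using Rq(1)[OF y] \<open>0 \<le> m\<close> by (rule mult_left_mono)
    also have "\<dots> = P / (k+1) * g y" using k Q by (simp add: m_def)
    also have "\<dots> \<le> p (Suc (Suc v)) y" by (rule Rp(2)[OF y])
    finally show "m * q (Suc (Suc v)) y \<le> p (Suc (Suc v)) y" .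
    have "p (Suc (Suc v)) y \<le> P / k * g y" by (rule Rp(1)[OF y])
    also have "\<dots> = M * (Q / (k+1) * g y)" using k Q by (simp add: M_def)
    also have "\<dots> \<le> M * q (Suc (Suc v)) y"
      using Rq(2)[OF y] by (rule mult_left_mono) (use P Q k in \<open>simp add: M_def\<close>)
    finally show "p (Suc (Suc v)) y \<le> M * q (Suc (Suc v)) y" .
  qed
  ultimately show ?thesis unfolding ratio_osc_def k_def by blast
qed

text \<open>The slacks \<open>p - m q\<close> and \<open>M q - p\<close> are nonnegative
  trajectories, so the rank-one bounds hold for them with the same \<open>e\<close> and
  \<open>g\<close> as for \<open>q\<close>. Each slack thereby dominates a multiple of
  \<open>q\<close> after the block, which raises \<open>m\<close> and lowers \<open>M\<close>; since
  the slacks add up to \<open>(M - m) q\<close>, the gap shrinks by a fixed factor.\<close>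

lemma ratio_osc_block_contract:
  assumes bl: "block D u v" and p: "trajectory D s p" and q: "trajectory D s q" and s: "s \<le> u"
    and nn: "\<And>y. y \<in> {0..1} \<Longrightarrow> 0 \<le> q u y"
    and osc: "ratio_osc p q \<tau> u" and nz: "\<exists>y\<in>{0..1}. q (Suc (Suc v)) y \<noteq> 0" and \<tau>: "0 \<le> \<tau>"
  shows "ratio_osc p q (\<tau> / 2) (Suc (Suc v))"
proof -
  obtain m M where m: "0 \<le> m" and Mm: "M - m \<le> \<tau> * m"
    and b: "\<And>y. y \<in> {0..1} \<Longrightarrow> m * q u y \<le> p u y \<and> p u y \<le> M * q u y"
    using osc by (auto simp: ratio_osc_def)
  obtain e g where e: "e \<in> {0..1}"
    and R: "\<And>p y. \<lbrakk>trajectory D (Suc u) p; \<forall>y\<in>{0..1}. 0 \<le> p (Suc u) y; monotone_dir (u \<in> D) (p (Suc u)); y \<in> {0..1}\<rbrakk> \<Longrightarrow>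
       p (Suc (Suc v)) y \<le> p (Suc v) e / real (v - u) * g y \<and>
         p (Suc v) e / real (Suc (v - u)) * g y \<le> p (Suc (Suc v)) y"
    using block_rank_one[OF bl] by blast
  have uv: "u < v" using bl by (simp add: block_def)
  \<comment> \<open>The slacks are only known to be nonnegative at state \<open>u\<close>; step
    \<open>u\<close> itself makes them monotone at state \<open>u + 1\<close>, as the rank-one
    bounds require.\<close>
  have R': "p (Suc (Suc v)) y \<le> p (Suc v) e / real (v - u) * g y"
         "p (Suc v) e / real (Suc (v - u)) * g y \<le> p (Suc (Suc v)) y"
         "0 \<le> p (Suc v) e"
    if p: "trajectory D s p" and nn: "\<And>y. y \<in> {0..1} \<Longrightarrow> 0 \<le> p u y" and y: "y \<in> {0..1}" for p y
    using R[OF trajectory_shift[OF p] _ monotone_dir_trajectory[OF p s nn] y]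
      trajectory_nonneg[OF p s nn] e s uv by auto
  define k where "k = real (v - u)"
  have k: "k \<ge> 1" and k1: "real (Suc (v - u)) = k + 1" using uv by (auto simp: k_def)
  define r where "r = (\<lambda>i y. 1 * p i y + (- m) * q i y)"
  define t where "t = (\<lambda>i y. M * q i y + (- 1) * p i y)"
  have r: "trajectory D s r" and t: "trajectory D s t"
    unfolding r_def t_def by (intro trajectory_lincomb p q)+
  have rnn: "0 \<le> r u y" and tnn: "0 \<le> t u y" if "y \<in> {0..1}" for y
    using b[OF that] by (auto simp: r_def t_def)
  define Q where "Q = q (Suc v) e"
  define Rs where "Rs = r (Suc v) e"
  define Ts where "Ts = t (Suc v) e"
  note Rq = R'[OF q nn, folded k_def Q_def, unfolded k1]
  note Rr = R'[OF r rnn, folded k_def Rs_def, unfolded k1]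
  note Rt = R'[OF t tnn, folded k_def Ts_def, unfolded k1]
  \<comment> \<open>An arbitrary point for instantiating \<open>R'\<close>, whose third conclusion
    does not involve \<open>y\<close>.\<close>
  have z: "(0::real) \<in> {0..1}" by simp
  have "Q \<noteq> 0"
  proof
    assume "Q = 0"
    then have "q (Suc (Suc v)) y = 0" if "y \<in> {0..1}" for y
      using Rq(1,2)[OF _ that] by simp
    then show False using nz by simp
  qed
  then have Q: "Q > 0" using Rq(3)[OF _ z] by simp
  have RT: "Rs + Ts = (M - m) * Q"
    by (simp add: Rs_def Ts_def Q_def r_def t_def algebra_simps)
  \<comment> \<open>The loss from comparing a lower bound with divisor \<open>k + 1\<close> to the
    upper bound of \<open>q\<close> with divisor \<open>k\<close>. The gap is multiplied by
    \<open>1 - c\<close>, which is at most 1/2.\<close>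
  define c where "c = k / (k + 1)"
  have c: "1/2 \<le> c" using k by (simp add: c_def field_simps)
  define m' where "m' = m + c * Rs / Q"
  define M' where "M' = M - c * Ts / Q"
  have mm: "m \<le> m'" using c Rr(3)[OF _ z] Q by (simp add: m'_def)
  have "M' - m' = (M - m) - c * ((Rs + Ts) / Q)"
    by (simp add: m'_def M'_def add_divide_distrib distrib_left)
  also have "\<dots> = (1 - c) * (M - m)" using Q by (simp add: RT field_simps)
  also have "\<dots> \<le> (1 - c) * (\<tau> * m)"
    using Mm k by (intro mult_left_mono) (auto simp: c_def)
  also have "\<dots> \<le> (1/2) * (\<tau> * m')"
    using c mm m \<tau> k by (intro mult_mono mult_left_mono) auto
  finally have "M' - m' \<le> \<tau> / 2 * m'" by simp
  moreover have "m' * q (Suc (Suc v)) y \<le> p (Suc (Suc v)) y \<and> p (Suc (Suc v)) y \<le> M' * q (Suc (Suc v)) y"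
    if y: "y \<in> {0..1}" for y
  proof -
    have *: "c * X / Q * q (Suc (Suc v)) y \<le> X / (k+1) * g y" if "0 \<le> X" for X
    proof -
      have "c * X / Q * q (Suc (Suc v)) y \<le> c * X / Q * (Q / k * g y)"
        using Rq(1)[OF _ y] by (rule mult_left_mono) (use c that Q in auto)
      also have "\<dots> = X / (k+1) * g y" using k Q by (simp add: c_def)
      finally show ?thesis .
    qed
    have "c * Rs / Q * q (Suc (Suc v)) y \<le> r (Suc (Suc v)) y"
      using *[OF Rr(3)[OF _ z]] Rr(2)[OF _ y] by linarith
    moreover have "c * Ts / Q * q (Suc (Suc v)) y \<le> t (Suc (Suc v)) y"
      using *[OF Rt(3)[OF _ z]] Rt(2)[OF _ y] by linarith
    ultimately show ?thesis by (simp add: r_def t_def m'_def M'_def algebra_simps)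
  qed
  moreover have "0 \<le> m'" using m mm by simp
  ultimately show ?thesis unfolding ratio_osc_def by blast
qed

section \<open>Finding blocks\<close>

lemma next_sign_change_block:
  assumes u: "sign_change D u" and i: "sign_change D i" "u < i"
  obtains v where "block D u v" "v \<le> i"
proof -
  define v where "v = (LEAST v. u < v \<and> sign_change D v)"
  have v: "u < v \<and> sign_change D v" and "v \<le> i"
    unfolding v_def using i LeastI[of "\<lambda>v. u < v \<and> sign_change D v" i] by (auto intro: Least_le)
  moreover have "\<not> sign_change D l" if "l \<in> {u<..<v}" for l
    using not_less_Least[of l "\<lambda>v. u < v \<and> sign_change D v"] that by (auto simp: v_def)
  ultimately have "block D u v" using u by (simp add: block_def)
  then show thesis using that \<open>v \<le> i\<close> by blast
qed

text \<open>Two successive windows of length \<open>R\<close> each contain a sign change; the block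
  runs from the first one to the next sign change after it.\<close>

lemma block_in_window:
  assumes window: "\<And>j. 1 \<le> j \<Longrightarrow> j + R < n \<Longrightarrow> \<exists>i\<in>{j..<j+R}. sign_change D i"
    and "1 \<le> j" "j + 2 * R < n"
  obtains u v where "block D u v" "j \<le> u" "v < j + 2 * R"
proof -
  obtain u where u: "u \<in> {j..<j+R}" "sign_change D u"
    using window[of j] assms(2,3) by auto
  obtain i where i: "i \<in> {Suc u..<Suc u+R}" "sign_change D i"
    using window[of "Suc u"] u assms(3) by auto
  obtain v where "block D u v" "v \<le> i"
    using next_sign_change_block[OF u(2) i(2)] i(1) by auto
  then show thesis using that[of u v] u(1) i(1) by simp
qed

text \<open>The last sign change before the stretch and the next one after it delimit a block. It
  contains the whole stretch, hence is longer than \<open>R\<close>.\<close>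

lemma block_around_constant_stretch:
  assumes no: "\<And>i. j \<le> i \<Longrightarrow> i < j + R \<Longrightarrow> \<not> sign_change D i"
    and a: "sign_change D a" "a < j" and b: "sign_change D b" "j + R \<le> b"
  obtains u v where "block D u v" "a \<le> u" "v \<le> b" "R < v - u"
proof -
  define u where "u = Max {i. i < j \<and> sign_change D i}"
  have "u \<in> {i. i < j \<and> sign_change D i}"
    unfolding u_def using a by (intro Max_in) auto
  then have u: "u < j" "sign_change D u" by auto
  have umax: "i \<le> u" if "i < j" "sign_change D i" for i
    unfolding u_def using that by (intro Max_ge) auto
  have "u < b" using u(1) b(2) by simp
  obtain v where v: "block D u v" "v \<le> b"
    using next_sign_change_block[OF u(2) b(1) \<open>u < b\<close>] .
  have "u < v" "sign_change D v" using v by (auto simp: block_def)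
  then have "j + R \<le> v" using umax[of v] no[of v] by fastforce
  then show thesis using that[OF v(1) umax[OF a(2,1)] v(2)] u by simp
qed

text \<open>A state that vanishes on the unit interval stays zero under all later steps.\<close>

lemma trajectory_nonzero_before:
  assumes q: "trajectory D s q" and "s \<le> i" "i \<le> j" "\<exists>y\<in>{0..1}. q j y \<noteq> 0"
  shows "\<exists>y\<in>{0..1}. q i y \<noteq> 0"
proof (rule ccontr)
  assume "\<not> ?thesis"
  then have z: "q i y = 0" if "y \<in> {0..1}" for y using that by auto
  have "q j y = 0" if "y \<in> {0..1}" for y
    using trajectory_le[OF q q assms(2) _ assms(3) that, of 1 0]
      trajectory_le[OF q q assms(2) _ assms(3) that, of 0 1] z by simp
  then show False using assms(4) by auto
qed

section \<open>Decay of the ratio oscillation for large n\<close>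

text \<open>The indices are cut into windows of length \<open>2 * R + 1\<close>, each holding a
  block: the first gives oscillation at most 3, every further one halves it. The extra 1 makes room
  for state \<open>v + 2\<close>, where the effect of a block is complete.\<close>

lemma ratio_osc_many_blocks:
  assumes p: "trajectory D 2 p" and q: "trajectory D 1 q"
    and nn: "\<And>y. y \<in> {0..1} \<Longrightarrow> 0 \<le> p 2 y" "\<And>y. y \<in> {0..1} \<Longrightarrow> 0 \<le> q 1 y"
    and init: "\<And>u v. block D u v \<Longrightarrow> 1 \<le> u \<Longrightarrow> Suc (Suc v) \<le> n \<Longrightarrow> ratio_osc p q (3 / real (v - u)) (Suc (Suc v))"
    and window: "\<And>j. 1 \<le> j \<Longrightarrow> j + R < n \<Longrightarrow> \<exists>i\<in>{j..<j+R}. sign_change D i"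
    and nz: "\<exists>y\<in>{0..1}. q n y \<noteq> 0"
    and n: "1 + Suc J * (2 * R + 1) \<le> n"
  shows "ratio_osc p q (3 / 2 ^ J) (1 + Suc J * (2 * R + 1))"
proof -
  have q2: "trajectory D 2 q" using trajectory_shift[OF q] by simp
  from n show ?thesis
  proof (induction J)
    case 0
    then have "1 + 2 * R < n" by simp
    from block_in_window[OF window order_refl this]
    obtain u v where uv: "block D u v" "1 \<le> u" "v < 1 + 2 * R" by auto
    have k: "3 / real (v - u) \<le> 3" using uv by (simp add: block_def divide_le_eq)
    have "ratio_osc p q (3 / real (v - u)) (Suc (Suc v))"
      using uv 0 by (intro init) auto
    then have "ratio_osc p q 3 (1 + Suc 0 * (2 * R + 1))"
      by (rule ratio_osc_le[OF p q2 _ _ _ k, rotated]) (use uv in auto)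
    then show ?case by simp
  next
    case (Suc J)
    define j where "j = 1 + Suc J * (2 * R + 1)"
    have j': "1 + Suc (Suc J) * (2 * R + 1) = j + 2 * R + 1" by (simp add: j_def)
    have jn: "j + 2 * R < n" using Suc.prems j' by simp
    obtain u v where uv: "block D u v" "j \<le> u" "v < j + 2 * R"
      by (rule block_in_window[OF window _ jn]) (auto simp: j_def)
    have j2: "2 \<le> j" by (simp add: j_def)
    have "ratio_osc p q (3 / 2 ^ J) j"
      using Suc by (simp add: j_def)
    then have "ratio_osc p q (3 / 2 ^ J) u"
      by (rule ratio_osc_le[OF p q2 j2 _ uv(2) order_refl])
    moreover have "0 \<le> q u y" if "y \<in> {0..1}" for y
      using trajectory_nonneg[OF q order_refl nn(2) _ that, of u] uv j2 by auto
    moreover have "\<exists>y\<in>{0..1}. q (Suc (Suc v)) y \<noteq> 0"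
      using uv jn by (intro trajectory_nonzero_before[OF q _ _ nz]) auto
    ultimately have "ratio_osc p q (3 / 2 ^ J / 2) (Suc (Suc v))"
      using uv j2 by (intro ratio_osc_block_contract[OF uv(1) p q2]) auto
    then have "ratio_osc p q (3 / 2 ^ Suc J) (j + 2 * R + 1)"
      by (rule ratio_osc_le[OF p q2, rotated]) (use uv j2 in \<open>auto simp: block_def\<close>)
    then show ?case by (simp only: j')
  qed
qed

text \<open>Either every window of length \<open>R\<close> has a sign change, which supplies
  \<open>J + 1\<close> blocks, or some stretch of length \<open>R\<close> has none and the single
  long block around it suffices. The sign changes near both ends ensure that this block closes on
  either side.\<close>

lemma ratio_osc_small:
  fixes \<tau> A :: real
  assumes \<tau>: "\<tau> > 0"
  shows "\<exists>n0. \<forall>n D p q. n0 \<le> n \<longrightarrow> trajectory D 2 p \<longrightarrow> trajectory D 1 q \<longrightarrow>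
     (\<forall>y\<in>{0..1}. 0 \<le> p 2 y) \<longrightarrow> (\<forall>y\<in>{0..1}. 0 \<le> q 1 y) \<longrightarrow> monotone_dir (1 \<in> D) (p 2) \<longrightarrow>
     (\<exists>u\<ge>1. real (Suc u) \<le> A \<and> sign_change D u) \<longrightarrow>
     (\<exists>w. real (n - w) \<le> A \<and> Suc w < n \<and> sign_change D w) \<longrightarrow>
     (\<exists>y\<in>{0..1}. q n y \<noteq> 0) \<longrightarrow> ratio_osc p q \<tau> n"
proof -
  \<comment> \<open>\<open>R\<close> is at least \<open>3 / \<tau>\<close>, so that one block longer
    than \<open>R\<close> suffices, and at least \<open>A\<close>, so that a stretch of length
    \<open>R\<close> separates the two given sign changes.\<close>
  obtain R :: nat where R: "max (max 1 A) (3 / \<tau>) \<le> R" using real_arch_simple by blast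
  have R1: "1 \<le> R" and RA: "A \<le> R" and R\<tau>: "3 / R \<le> \<tau>"
    using R \<tau> by (auto simp: field_simps)
  obtain J where "(1/2) ^ J < \<tau> / 3" using real_arch_pow_inv[of "\<tau>/3" "1/2"] \<tau> by auto
  then have J: "3 / 2 ^ J \<le> \<tau>" by (simp add: power_one_over field_simps)
  show ?thesis
  proof (intro exI allI impI)
    fix n D p q
    assume n: "1 + Suc J * (2 * R + 1) \<le> n" and p: "trajectory D 2 p" and q: "trajectory D 1 q"
      and nn': "\<forall>y\<in>{0..1::real}. 0 \<le> p 2 y" "\<forall>y\<in>{0..1::real}. 0 \<le> q 1 y"
      and mono: "monotone_dir (1 \<in> D) (p 2)"
      and first: "\<exists>u\<ge>1. real (Suc u) \<le> A \<and> sign_change D u"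
      and last: "\<exists>w. real (n - w) \<le> A \<and> Suc w < n \<and> sign_change D w"
      and nz: "\<exists>y\<in>{0..1}. q n y \<noteq> 0"
    have nn: "0 \<le> p 2 y" "0 \<le> q 1 y" if "y \<in> {0..1}" for y using nn' that by auto
    have init: "ratio_osc p q (3 / real (v - u)) (Suc (Suc v))"
      if bl: "block D u v" and u: "1 \<le> u" and v: "Suc (Suc v) \<le> n" for u v
    proof (rule ratio_osc_block_initial[OF bl])
      have q': "0 \<le> q i y" if "1 \<le> i" "y \<in> {0..1}" for i y
        using trajectory_nonneg[OF q order_refl nn(2) that] .
      have p': "0 \<le> p i y" if "2 \<le> i" "y \<in> {0..1}" for i y
        using trajectory_nonneg[OF p order_refl nn(1) that] .
      show "trajectory D (Suc u) p" "trajectory D (Suc u) q"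
        using trajectory_shift[OF p, of "Suc u"] trajectory_shift[OF q, of "Suc u"] u by auto
      show "0 \<le> p (Suc u) y" "0 \<le> q (Suc u) y" if "y \<in> {0..1}" for y
        using p'[OF _ that] q'[OF _ that] u by auto
      \<comment> \<open>For \<open>u = 1\<close> the state concerned is the start of
        \<open>p\<close>, whose monotonicity is assumed; later states get it from the preceding
        step.\<close>
      show "monotone_dir (u \<in> D) (p (Suc u))"
      proof (cases "u = 1")
        case True
        then show ?thesis using mono by (simp add: numeral_2_eq_2)
      next
        case False
        then show ?thesis using u p' by (intro monotone_dir_trajectory[OF p]) auto
      qed
      show "monotone_dir (u \<in> D) (q (Suc u))"
        using u q' by (intro monotone_dir_trajectory[OF q]) auto
      show "\<exists>y\<in>{0..1}. q (Suc (Suc v)) y \<noteq> 0"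
        using v by (intro trajectory_nonzero_before[OF q _ _ nz]) auto
    qed
    show "ratio_osc p q \<tau> n"
    proof (cases "\<forall>j\<ge>1. j + R < n \<longrightarrow> (\<exists>i\<in>{j..<j+R}. sign_change D i)")
      case True
      have "ratio_osc p q (3 / 2 ^ J) (1 + Suc J * (2 * R + 1))"
        by (rule ratio_osc_many_blocks[OF p q nn init _ nz n]) (use True in auto)
      then show ?thesis
        by (rule ratio_osc_le[OF p trajectory_shift[OF q], rotated 2]) (use n J R1 in auto)
    next
      case False
      then obtain j where j: "1 \<le> j" "j + R < n" and no: "\<And>i. j \<le> i \<Longrightarrow> i < j + R \<Longrightarrow> \<not> sign_change D i"
        by auto
      obtain a where a: "1 \<le> a" "real (Suc a) \<le> A" "sign_change D a" using first by auto
      obtain b where b: "real (n - b) \<le> A" "Suc b < n" "sign_change D b" using last by auto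
      have "Suc a \<le> R" "n - b \<le> R" using a b RA by linarith+
      \<comment> \<open>\<open>a\<close> is below \<open>j + R\<close> and \<open>b\<close> is not
        below \<open>j\<close>; neither can lie in the stretch.\<close>
      then have "a < j" "j + R \<le> b" using no[of a] no[of b] a b j by fastforce+
      from block_around_constant_stretch[OF no a(3) this(1) b(3) this(2)]
      obtain u v where uv: "block D u v" "a \<le> u" "v \<le> b" "R < v - u" by blast
      have "3 / real (v - u) \<le> 3 / R" using uv R1 by (intro divide_left_mono) auto
      then show ?thesis
        using uv a b R\<tau> init[OF uv(1)]
        by (intro ratio_osc_le[OF p trajectory_shift[OF q] _ init[OF uv(1)]]) auto
    qed
  qed
qed

section \<open>Bounds for the marginal densities\<close>

text \<open>Along the first run \<open>q\<close> is one integration ahead of \<open>p\<close>, so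
  near one end of the interval their quotient may be large. The opposite step after the run repairs
  this: (1 - y^u)/u! is compared with (1 - y^(u+1))/(u+1)!, and the quotient is at most u + 1, the
  length of the run.\<close>

lemma first_run_bound:
  assumes p: "trajectory D 2 p" and q: "trajectory D 1 q"
    and p2: "\<And>y. y \<in> {0..1} \<Longrightarrow> p 2 y \<le> 1" and q1: "\<And>y. y \<in> {0..1} \<Longrightarrow> q 1 y = 1"
    and u: "1 \<le> u" "sign_change D u" and no: "\<And>i. 1 \<le> i \<Longrightarrow> i < u \<Longrightarrow> \<not> sign_change D i"
    and y: "y \<in> {0..1}"
  shows "p (Suc (Suc u)) y \<le> real (Suc u) * q (Suc (Suc u)) y"
proof -
  have up: "p (Suc (Suc u)) y \<le> real (Suc u) * q (Suc (Suc u)) y"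
    if p: "trajectory D 2 p" and q: "trajectory D 1 q" and nD: "1 \<notin> D"
      and u2: "sign_change D u" and no: "\<And>i. 1 \<le> i \<Longrightarrow> i < u \<Longrightarrow> \<not> sign_change D i"
      and p2: "\<And>y. y \<in> {0..1} \<Longrightarrow> p 2 y \<le> 1" and q1: "\<And>y. y \<in> {0..1} \<Longrightarrow> q 1 y = 1"
      and y: "y \<in> {0..1}" for D p q y
  proof -
    have nD': "i \<notin> D" if "1 \<le> i" "i \<le> u" for i
      using no_sign_change_const[of 1 u D i] no that nD by auto
    have claim: "p (Suc (Suc j)) y \<le> y ^ j / fact j \<and> q (Suc (Suc j)) y = y ^ Suc j / fact (Suc j)"
      if "Suc j \<le> u" "y \<in> {0..1}" for j y
      using that
    proof (induction j arbitrary: y)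
      case 0
      have "1 \<notin> D" using nD' 0 by simp
      have "q 2 y = integral {0..y} (q 1)"
        using trajectory_Suc[OF q order_refl 0(2)] \<open>1 \<notin> D\<close> by (simp add: step_op_def numeral_2_eq_2)
      also have "\<dots> = integral {0..y} (\<lambda>_. 1)" using q1 0 by (intro integral_cong) auto
      finally show ?case using p2[OF 0(2)] 0 by (simp add: numeral_2_eq_2)
    next
      case (Suc j)
      have nDj: "Suc (Suc j) \<notin> D" using nD'[of "Suc (Suc j)"] Suc.prems by simp
      have pw: "((\<lambda>t. t ^ i / fact i) has_integral (y ^ Suc i / fact (Suc i))) {0..y}" for i
        using has_integral_mult_left[OF integral_power_interval[of 0 y i], of "1 / fact i"] Suc.prems
        by (simp add: mult.commute del: power_Suc of_nat_Suc)
      have "p (Suc (Suc (Suc j))) y = integral {0..y} (p (Suc (Suc j)))"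
        using trajectory_Suc[OF p _ Suc.prems(2), of "Suc (Suc j)"] nDj by (simp add: step_op_def)
      also have "\<dots> \<le> integral {0..y} (\<lambda>t. t ^ j / fact j)"
      proof (rule integral_le)
        show "p (Suc (Suc j)) integrable_on {0..y}"
          using Suc.prems by (intro integrable_on_sub01[OF trajectory_integrable[OF p]]) auto
        show "(\<lambda>t. t ^ j / fact j) integrable_on {0..y}" using pw[of j] by blast
        show "p (Suc (Suc j)) t \<le> t ^ j / fact j" if "t \<in> {0..y}" for t
          using Suc.IH[of t] Suc.prems that by simp
      qed
      also have "\<dots> = y ^ Suc j / fact (Suc j)" by (rule integral_unique[OF pw])
      finally have 1: "p (Suc (Suc (Suc j))) y \<le> y ^ Suc j / fact (Suc j)" .
      have "q (Suc (Suc (Suc j))) y = integral {0..y} (q (Suc (Suc j)))"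
        using trajectory_Suc[OF q _ Suc.prems(2), of "Suc (Suc j)"] nDj by (simp add: step_op_def)
      also have "\<dots> = integral {0..y} (\<lambda>t. t ^ Suc j / fact (Suc j))"
        using Suc by (intro integral_cong) auto
      also have "\<dots> = y ^ Suc (Suc j) / fact (Suc (Suc j))" by (rule integral_unique[OF pw])
      finally show ?case using 1 by blast
    qed
    obtain l where l: "u = Suc l" using u by (cases u) auto
    have D: "Suc u \<in> D" using nD'[of u] u2 u by (auto simp: sign_change_def)
    have pw: "((\<lambda>t. t ^ i / fact i) has_integral ((1 - y ^ Suc i) / fact (Suc i))) {y..1}" for i
      using has_integral_mult_left[OF integral_power_interval[of y 1 i], of "1 / fact i"] y
      by (simp add: mult.commute del: power_Suc of_nat_Suc)
    have "p (Suc (Suc u)) y = integral {y..1} (p (Suc u))"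
      using trajectory_Suc[OF p _ y, of "Suc u"] D u by (simp add: step_op_def)
    also have "\<dots> \<le> integral {y..1} (\<lambda>t. t ^ l / fact l)"
    proof (rule integral_le)
      show "p (Suc u) integrable_on {y..1}"
        using y u by (intro integrable_on_sub01[OF trajectory_integrable[OF p]]) auto
      show "(\<lambda>t. t ^ l / fact l) integrable_on {y..1}" using pw[of l] by blast
      show "p (Suc u) t \<le> t ^ l / fact l" if "t \<in> {y..1}" for t
        using claim[of l t] l y that by simp
    qed
    also have "\<dots> = (1 - y ^ u) / fact u" using integral_unique[OF pw] l by simp
    also have "\<dots> \<le> (1 - y ^ Suc u) / fact u"
      using y by (intro divide_right_mono) (auto simp: mult_left_le_one_le)
    also have "\<dots> = real (Suc u) * ((1 - y ^ Suc u) / fact (Suc u))"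
      by simp
    also have "(1 - y ^ Suc u) / fact (Suc u) = integral {y..1} (\<lambda>t. t ^ u / fact u)"
      using integral_unique[OF pw] by metis
    also have "\<dots> = integral {y..1} (q (Suc u))"
      using claim[of l] y l by (intro integral_cong) auto
    also have "\<dots> = q (Suc (Suc u)) y"
      using trajectory_Suc[OF q _ y, of "Suc u"] D u by (simp add: step_op_def)
    finally show ?thesis .
  qed
  show ?thesis
  proof (cases "1 \<in> D")
    case False
    then show ?thesis using up[OF p q False u(2) no p2 q1 y] by blast
  next
    case True
    show ?thesis
      using up[OF trajectory_reflect[OF p] trajectory_reflect[OF q], of "1 - y"] True u no p2 q1 y
      by (simp add: sign_change_Compl)
  qed
qed

text \<open>For an ascending last run the final state is largest at 1, and its integral is at least
  its value there divided by \<open>n - w\<close>, the length of the run.\<close>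

lemma last_run_bound:
  assumes q: "trajectory D s q" and w: "s \<le> w" "Suc w < n" "sign_change D w"
    and nn: "\<And>y. y \<in> {0..1} \<Longrightarrow> 0 \<le> q w y"
    and no: "\<And>i. w < i \<Longrightarrow> Suc i < n \<Longrightarrow> \<not> sign_change D i" and y: "y \<in> {0..1}"
  shows "q n y \<le> real (n - w) * integral {0..1} (q n)"
proof -
  have up: "q n y \<le> real (n - w) * integral {0..1} (q n)"
    if q: "trajectory D s q" and w3: "sign_change D w" and wD: "w \<in> D"
      and nn: "\<And>y. y \<in> {0..1} \<Longrightarrow> 0 \<le> q w y"
      and no: "\<And>i. w < i \<Longrightarrow> Suc i < n \<Longrightarrow> \<not> sign_change D i" and y: "y \<in> {0..1}" for D q y
  proof -
    obtain l where l: "n = Suc w + Suc l" using w by (metis less_imp_Suc_add add_Suc_right)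
    have q': "trajectory D (Suc w) q" using trajectory_shift[OF q] w by simp
    have nn': "0 \<le> q j y" if "w \<le> j" "y \<in> {0..1}" for j y
      using trajectory_nonneg[OF q w(1) nn that] .
    have anti: "antimono_on {0..1} (q (Suc w))"
      using monotone_dir_trajectory[OF q w(1) nn] wD by (simp add: monotone_dir_def)
    have up: "i \<notin> D" if "Suc w \<le> i" "i < Suc w + Suc l" for i
      using no_sign_change_const[of "Suc w" "w + Suc l" D i] no that wD w3 l by (auto simp: sign_change_def)
    have "q n (y * 1) \<le> y ^ l * q n 1"
      unfolding l by (rule up_run_scale_le[OF q']) (use up nn' y in auto)
    also have "\<dots> \<le> q n 1"
      using y nn'[of n 1] w by (intro mult_left_le_one_le) (auto simp: power_le_one)
    finally have "q n y \<le> q n 1" by simp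
    moreover have "q n 1 / Suc (Suc l) \<le> integral {0..1} (q n)"
      unfolding l by (rule up_run_integral_ge[OF q' anti]) (use up in auto)
    ultimately show ?thesis by (simp add: l field_simps)
  qed
  show ?thesis
  proof (cases "w \<in> D")
    case True
    then show ?thesis using up[OF q w(3) True nn no y] by blast
  next
    case False
    have "n \<ge> s" using w by simp
    have "integral {0..1} (\<lambda>y. q n (1 - y)) = integral {0..1} (q n)"
      using integral_unique[OF integral_reflect01[OF trajectory_integrable[OF q \<open>n \<ge> s\<close>], of 0 1]] by simp
    then show ?thesis
      using up[OF trajectory_reflect[OF q], of "1 - y"] False w no nn y
      by (simp add: sign_change_Compl)
  qed
qed

section \<open>Densities as trajectories\<close>

text \<open>Indices below \<open>s\<close> merely repeat the start function, so that primitive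
  recursion from 0 reaches \<open>f\<close> at \<open>s\<close>.\<close>

primrec evolution :: "nat set \<Rightarrow> nat \<Rightarrow> (real \<Rightarrow> real) \<Rightarrow> nat \<Rightarrow> real \<Rightarrow> real" where
  "evolution D s f 0 = f"
| "evolution D s f (Suc i) = (if i < s then f else step_op (i \<in> D) (evolution D s f i))"

lemma evolution_start [simp]: "evolution D s f s = f"
  by (cases s) auto

lemma trajectory_evolution:
  assumes "f integrable_on {0..1}"
  shows "trajectory D s (evolution D s f)"
  using assms by (simp add: trajectory_def)

section \<open>Iterated integrals over sequences with a prescribed pattern\<close>

text \<open>The start set \<open>G\<close> allows one notion to serve twice: it is the unit interval
  for the full polytope, and the range left to the second coordinate once the first is
  fixed.\<close>

definition chain :: "nat set \<Rightarrow> nat \<Rightarrow> nat \<Rightarrow> real set \<Rightarrow> (nat \<Rightarrow> real) \<Rightarrow> bool" where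
  "chain D s n G x \<longleftrightarrow> x s \<in> G \<and> (\<forall>i\<in>{s..n}. 0 \<le> x i \<and> x i \<le> 1) \<and>
     (\<forall>i\<in>{s..<n}. if i \<in> D then x (Suc i) \<le> x i else x i \<le> x (Suc i))"

interpretation lborel_product: product_sigma_finite "\<lambda>_::nat. lborel :: real measure"
  by unfold_locales

lemma measurable_chain:
  assumes "G \<in> sets borel" "s \<le> n"
  shows "Measurable.pred (PiM {s..n} (\<lambda>_. lborel)) (chain D s n G)"
proof -
  let ?M = "PiM {s..n} (\<lambda>_. lborel :: real measure)"
  have c: "(\<lambda>x. x i) \<in> borel_measurable ?M" if "i \<in> {s..n}" for i
    using measurable_component_singleton[OF that, of "\<lambda>_. lborel"] by simp
  have le: "Measurable.pred ?M (\<lambda>x. f x \<le> g x)"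
    if "f \<in> borel_measurable ?M" "g \<in> borel_measurable ?M" for f g :: "(nat \<Rightarrow> real) \<Rightarrow> real"
    using borel_measurable_le[OF that] by (simp add: pred_def)
  have "Measurable.pred ?M (\<lambda>x. x s \<in> G)"
    by (rule pred_sets2[OF assms(1) c]) (use assms(2) in simp)
  moreover have "Measurable.pred ?M (\<lambda>x. \<forall>i\<in>{s..n}. 0 \<le> x i \<and> x i \<le> 1)"
    by (intro pred_intros_finite(3) pred_intros_logic(3) le c borel_measurable_const) auto
  moreover have "Measurable.pred ?M
      (\<lambda>x. \<forall>i\<in>{s..<n}. if i \<in> D then x (Suc i) \<le> x i else x i \<le> x (Suc i))"
  proof (intro pred_intros_finite(3))
    fix i assume "i \<in> {s..<n}"
    then show "Measurable.pred ?M (\<lambda>x. if i \<in> D then x (Suc i) \<le> x i else x i \<le> x (Suc i))"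
      using le[OF c c, of i "Suc i"] le[OF c c, of "Suc i" i] by (cases "i \<in> D") auto
  qed simp
  ultimately show ?thesis unfolding chain_def[abs_def] by (intro pred_intros_logic(3))
qed

lemma measurable_chain_upd:
  assumes "G \<in> sets borel" "s \<le> n"
  shows "Measurable.pred (PiM {s..<n} (\<lambda>_. lborel)) (\<lambda>z. chain D s n G (z(n := y)))"
proof -
  have "(\<lambda>z. z(n := y)) \<in> measurable (PiM {s..<n} (\<lambda>_. lborel)) (PiM {s..n} (\<lambda>_. lborel))"
    using assms(2) by (intro measurable_fun_upd[where J="{s..<n}"]) auto
  from measurable_compose[OF this measurable_chain[OF assms]] show ?thesis .
qed

lemma chain_Suc:
  assumes "s \<le> n" "y \<in> {0..1}"
  shows "chain D s (Suc n) G (z(n := u, Suc n := y)) \<longleftrightarrow>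
    chain D s n G (z(n := u)) \<and> (if n \<in> D then y \<le> u else u \<le> y)"
proof -
  have "{s..Suc n} = insert (Suc n) {s..n}" "{s..<Suc n} = insert n {s..<n}" using assms(1) by auto
  then show ?thesis using assms by (auto simp: chain_def)
qed

lemma chain_in_unit:
  assumes "chain D s n G (z(n := y))" "s \<le> n"
  shows "y \<in> {0..1}"
  using assms unfolding chain_def by (metis atLeastAtMost_iff fun_upd_same order_refl)

text \<open>Induction on \<open>n\<close> with Tonelli: the coordinate next to the fixed last one is
  integrated outermost, the inner integral is the previous state, and the outer one is a
  step.\<close>

lemma nn_integral_chain:
  assumes G: "G \<in> sets borel" "G \<subseteq> {0..1}" and f: "(indicator G :: real \<Rightarrow> real) integrable_on {0..1}"
    and n: "s \<le> n" and y: "y \<in> {0..1}"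
  shows "(\<integral>\<^sup>+z. indicator {x. chain D s n G x} (z(n := y)) \<partial>PiM {s..<n} (\<lambda>_. lborel))
      = ennreal (evolution D s (indicator G) n y)"
  using n y
proof (induction n arbitrary: y rule: dec_induct)
  case base
  have "(\<lambda>z :: nat \<Rightarrow> real. indicator {x. chain D s s G x} (z(s := y))) = (\<lambda>_. indicator G y :: ennreal)"
    using base by (auto simp: chain_def indicator_def)
  then show ?case
    by (simp only: evolution_start) (simp add: PiM_empty nn_integral_count_space_finite ennreal_indicator)
next
  case (step n)
  have T: "trajectory D s (evolution D s (indicator G))" by (rule trajectory_evolution[OF f])
  have nn: "0 \<le> evolution D s (indicator G) n u" if "u \<in> {0..1}" for u
    using trajectory_nonneg[OF T order_refl _ step(1) that] by simp
  \<comment> \<open>The values left to coordinate \<open>n\<close> when coordinate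
    \<open>n + 1\<close> equals \<open>y\<close>.\<close>
  define W where "W = (if n \<in> D then {y..1} else {0..y})"
  have W: "W \<subseteq> {0..1}" using step.prems by (auto simp: W_def)
  have meas: "(\<lambda>z. indicator {x. chain D s (Suc n) G x} (z(Suc n := y))) \<in>
      borel_measurable (PiM (insert n {s..<n}) (\<lambda>_. lborel))"
    using measurable_chain_upd[OF G(1), of s "Suc n" D y] step(1)
    by (simp add: indicator_def atLeastLessThanSuc)
  have "(\<integral>\<^sup>+z. indicator {x. chain D s (Suc n) G x} (z(Suc n := y)) \<partial>PiM {s..<Suc n} (\<lambda>_. lborel))
     = (\<integral>\<^sup>+u. (\<integral>\<^sup>+z. indicator {x. chain D s (Suc n) G x} (z(n := u, Suc n := y)) \<partial>PiM {s..<n} (\<lambda>_. lborel)) \<partial>lborel)"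
    using lborel_product.product_nn_integral_insert_rev[OF _ _ meas] step(1)
    by (simp add: atLeastLessThanSuc)
  also have "\<dots> = (\<integral>\<^sup>+u. ennreal (indicator W u * evolution D s (indicator G) n u) \<partial>lborel)"
  proof (rule nn_integral_cong)
    fix u :: real
    show "(\<integral>\<^sup>+z. indicator {x. chain D s (Suc n) G x} (z(n := u, Suc n := y)) \<partial>PiM {s..<n} (\<lambda>_. lborel))
      = ennreal (indicator W u * evolution D s (indicator G) n u)"
    proof (cases "u \<in> W")
      case True
      then have "chain D s (Suc n) G (z(n := u, Suc n := y)) \<longleftrightarrow> chain D s n G (z(n := u))" for z
        using chain_Suc[OF step(1) step.prems] by (auto simp: W_def split: if_splits)
      then have "indicator {x. chain D s (Suc n) G x} (z(n := u, Suc n := y))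
          = (indicator {x. chain D s n G x} (z(n := u)) :: ennreal)" for z
        by (simp add: indicator_def)
      moreover have "u \<in> {0..1}" using True W by blast
      ultimately show ?thesis using True by (simp only: step.IH indicator_simps mult_1)
    next
      case False
      then have "\<not> chain D s (Suc n) G (z(n := u, Suc n := y))" for z
        using chain_Suc[OF step(1) step.prems] chain_in_unit[of D s n G z u] step(1)
        by (auto simp: W_def split: if_splits)
      then show ?thesis using False by simp
    qed
  qed
  also have "\<dots> = ennreal (integral W (evolution D s (indicator G) n))"
  proof (rule nn_integral_has_integral_lebesgue)
    show "0 \<le> evolution D s (indicator G) n x" if "x \<in> W" for x using nn that W by auto
    show "(evolution D s (indicator G) n has_integral integral W (evolution D s (indicator G) n)) W"
      using step.prems integrable_on_sub01[OF trajectory_integrable[OF T step(1)]] by (auto simp: W_def)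
  qed
  also have "integral W (evolution D s (indicator G) n) = evolution D s (indicator G) (Suc n) y"
    using step(1) by (simp add: W_def step_op_def)
  finally show ?case .
qed

text \<open>One further integration, over the last coordinate, of the value found for fixed last
  coordinate.\<close>

lemma nn_integral_chain_total:
  assumes G: "G \<in> sets borel" "G \<subseteq> {0..1}" and f: "(indicator G :: real \<Rightarrow> real) integrable_on {0..1}"
    and n: "s \<le> n"
  shows "(\<integral>\<^sup>+x. indicator {x. chain D s n G x} x \<partial>PiM {s..n} (\<lambda>_. lborel))
      = ennreal (integral {0..1} (evolution D s (indicator G) n))"
proof -
  have T: "trajectory D s (evolution D s (indicator G))" by (rule trajectory_evolution[OF f])
  have nn: "0 \<le> evolution D s (indicator G) n u" if "u \<in> {0..1}" for u
    using trajectory_nonneg[OF T order_refl _ n that] by simp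
  have ins: "{s..n} = insert n {s..<n}" using n by auto
  have meas: "(\<lambda>x. indicator {x. chain D s n G x} x) \<in> borel_measurable (PiM (insert n {s..<n}) (\<lambda>_. lborel))"
    using measurable_chain[OF G(1) n, of D] by (simp add: indicator_def ins)
  have "(\<integral>\<^sup>+x. indicator {x. chain D s n G x} x \<partial>PiM {s..n} (\<lambda>_. lborel))
     = (\<integral>\<^sup>+u. (\<integral>\<^sup>+z. indicator {x. chain D s n G x} (z(n := u)) \<partial>PiM {s..<n} (\<lambda>_. lborel)) \<partial>lborel)"
    using lborel_product.product_nn_integral_insert_rev[OF _ _ meas] by (simp add: ins)
  also have "\<dots> = (\<integral>\<^sup>+u. ennreal (indicator {0..1} u * evolution D s (indicator G) n u) \<partial>lborel)"
  proof (rule nn_integral_cong)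
    fix u :: real
    show "(\<integral>\<^sup>+z. indicator {x. chain D s n G x} (z(n := u)) \<partial>PiM {s..<n} (\<lambda>_. lborel))
      = ennreal (indicator {0..1} u * evolution D s (indicator G) n u)"
    proof (cases "u \<in> {0..1}")
      case True
      then show ?thesis using nn_integral_chain[OF G f n True] by simp
    next
      case False
      then have "\<not> chain D s n G (z(n := u))" for z
        using chain_in_unit[of D s n G z u] n by auto
      then show ?thesis using False by simp
    qed
  qed
  also have "\<dots> = ennreal (integral {0..1} (evolution D s (indicator G) n))"
    using nn trajectory_integrable[OF T n]
    by (intro nn_integral_has_integral_lebesgue integrable_integral) auto
  finally show ?thesis .
qed

lemma measure_eq_of_nn_integral:
  assumes "Measurable.pred M P" "(\<integral>\<^sup>+x. indicator {x. P x} x \<partial>M) = ennreal r" "0 \<le> r"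
    and A: "\<And>x. x \<in> A \<longleftrightarrow> x \<in> space M \<and> P x"
  shows "measure M A = r"
proof -
  have A': "A = {x \<in> space M. P x}" using A by blast
  then have "A \<in> sets M" using assms(1) by (simp add: pred_def)
  then have "emeasure M A = (\<integral>\<^sup>+x. indicator A x \<partial>M)" by simp
  also have "\<dots> = (\<integral>\<^sup>+x. indicator {x. P x} x \<partial>M)"
    by (intro nn_integral_cong) (auto simp: A' indicator_def)
  finally show ?thesis using assms(2,3) by (simp add: measure_def)
qed

text \<open>Once the first coordinate is fixed, step 1 becomes a constraint on the second alone and
  moves into the start set.\<close>

lemma chain_first:
  assumes "2 \<le> n"
  shows "chain D 1 n {0..1} x \<longleftrightarrow>
    x 1 \<in> {0..1} \<and> chain D 2 n (if 1 \<in> D then {0..x 1} else {x 1..1}) x"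
proof -
  have "{1..n} = insert 1 {2..n}" "{1..<n} = insert 1 {2..<n}" using assms by auto
  then show ?thesis using assms by (auto simp: chain_def numeral_2_eq_2)
qed

lemma chain_cong:
  assumes "s \<le> n" "\<And>i. i \<in> {s..n} \<Longrightarrow> x i = y i"
  shows "chain D s n G x = chain D s n G y"
  using assms by (simp add: chain_def)

lemma polytope_chain:
  assumes "1 \<le> sum_list lam"
  shows "x \<in> polytope lam \<longleftrightarrow> x \<in> {1..sum_list lam} \<rightarrow>\<^sub>E UNIV \<and>
    chain (descents lam) 1 (sum_list lam) {0..1} x"
  using assms by (auto simp: polytope_def chain_def Let_def)

section \<open>The densities of a composition expressed by evolutions\<close>

text \<open>\<open>q\<close> integrates out the coordinates from the first one on.
  \<open>p x\<close> has the first coordinate fixed at \<open>x\<close>, hence starts at index 2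
  with the indicator of the values allowed there.\<close>

context
  fixes lam :: "nat list" and n :: nat and D :: "nat set" and q :: "nat \<Rightarrow> real \<Rightarrow> real"
    and p :: "real \<Rightarrow> nat \<Rightarrow> real \<Rightarrow> real"
  assumes n: "sum_list lam = n" "3 \<le> n" and D: "D = descents lam"
    and q: "q = evolution D 1 (indicator {0..1})"
    and p: "\<And>x. p x = evolution D 2 (indicator (if 1 \<in> D then {0..x} else {x..1}))"
begin

lemma indicator_unit_integrable: "(indicator {0..1} :: real \<Rightarrow> real) integrable_on {0..1}"
  by (subst integrable_cong[of _ _ "\<lambda>_. 1"]) auto

lemma indicator_start_integrable:
  assumes "x \<in> {0..1::real}"
  shows "(indicator (if b then {0..x} else {x..1}) :: real \<Rightarrow> real) integrable_on {0..1}"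
  using assms by (auto simp: integrable_on_indicator Int_absorb2 fmeasurable_cbox[where 'a=real, simplified] intro!: fmeasurable.Int)

lemma trajectory_q: "trajectory D 1 q"
  unfolding q by (rule trajectory_evolution[OF indicator_unit_integrable])

lemma trajectory_p: "x \<in> {0..1} \<Longrightarrow> trajectory D 2 (p x)"
  unfolding p by (rule trajectory_evolution[OF indicator_start_integrable])

lemma q_nonneg: "1 \<le> i \<Longrightarrow> y \<in> {0..1} \<Longrightarrow> 0 \<le> q i y"
  by (rule trajectory_nonneg[OF trajectory_q order_refl]) (auto simp: q)

lemma p_nonneg: "x \<in> {0..1} \<Longrightarrow> 2 \<le> i \<Longrightarrow> y \<in> {0..1} \<Longrightarrow> 0 \<le> p x i y"
  by (rule trajectory_nonneg[OF trajectory_p order_refl]) (auto simp: p)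

lemma vol_poly_eq: "vol_poly lam = integral {0..1} (q n)"
  unfolding vol_poly_def n(1)
proof (rule measure_eq_of_nn_integral[where P = "chain D 1 n {0..1}"])
  show "Measurable.pred (Pi\<^sub>M {1..n} (\<lambda>_. lborel)) (chain D 1 n {0..1})"
    using n by (intro measurable_chain) auto
  show "(\<integral>\<^sup>+x. indicator {x. chain D 1 n {0..1} x} x \<partial>Pi\<^sub>M {1..n} (\<lambda>_. lborel)) = ennreal (integral {0..1} (q n))"
    unfolding q using n by (intro nn_integral_chain_total indicator_unit_integrable) auto
  show "0 \<le> integral {0..1} (q n)"
    using n q_nonneg trajectory_integrable[OF trajectory_q] by (intro integral_nonneg) auto
  show "x \<in> polytope lam \<longleftrightarrow> x \<in> space (Pi\<^sub>M {1..n} (\<lambda>_. lborel)) \<and> chain D 1 n {0..1} x" for x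
    using polytope_chain[of lam x] n D by (simp add: space_PiM)
qed

lemma dens_last_eq:
  assumes y: "y \<in> {0..1}"
  shows "dens_last lam y = q n y / vol_poly lam"
proof -
  have "measure (Pi\<^sub>M {1..<n} (\<lambda>_. lborel)) {z \<in> {1..<n} \<rightarrow>\<^sub>E UNIV.
      (\<lambda>i. if i = n then y else if i \<in> {1..<n} then z i else undefined) \<in> polytope lam} = q n y"
  proof (rule measure_eq_of_nn_integral[where P = "\<lambda>z. chain D 1 n {0..1} (z(n := y))"])
    show "Measurable.pred (Pi\<^sub>M {1..<n} (\<lambda>_. lborel)) (\<lambda>z. chain D 1 n {0..1} (z(n := y)))"
      using n by (intro measurable_chain_upd) auto
    show "(\<integral>\<^sup>+z. indicator {z. chain D 1 n {0..1} (z(n := y))} z \<partial>Pi\<^sub>M {1..<n} (\<lambda>_. lborel)) = ennreal (q n y)"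
      unfolding q using nn_integral_chain[OF _ _ indicator_unit_integrable _ y, of 1 n D] n
      by (simp add: indicator_def)
    show "0 \<le> q n y" using q_nonneg[OF _ y] n by simp
    fix z :: "nat \<Rightarrow> real"
    \<comment> \<open>Both functions agree on the indices from 1 to \<open>n\<close>, the only ones
      \<open>chain\<close> inspects.\<close>
    have "chain D 1 n {0..1} (\<lambda>i. if i = n then y else if i \<in> {1..<n} then z i else undefined)
        = chain D 1 n {0..1} (z(n := y))"
      using n by (intro chain_cong) auto
    then show "z \<in> {z \<in> {1..<n} \<rightarrow>\<^sub>E UNIV.
        (\<lambda>i. if i = n then y else if i \<in> {1..<n} then z i else undefined) \<in> polytope lam} \<longleftrightarrow>
      z \<in> space (Pi\<^sub>M {1..<n} (\<lambda>_. lborel)) \<and> chain D 1 n {0..1} (z(n := y))"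
      using polytope_chain[of lam] n D by (auto simp: space_PiM PiE_iff extensional_def)
  qed
  then show ?thesis by (simp add: dens_last_def n Let_def)
qed

lemma dens_joint_eq:
  assumes x: "x \<in> {0..1}" and y: "y \<in> {0..1}"
  shows "dens_joint lam x y = p x n y / vol_poly lam"
proof -
  let ?G = "if 1 \<in> D then {0..x} else {x..1}"
  have "measure (Pi\<^sub>M {2..<n} (\<lambda>_. lborel)) {z \<in> {2..<n} \<rightarrow>\<^sub>E UNIV.
      (\<lambda>i. if i = 1 then x else if i = n then y else if i \<in> {2..<n} then z i else undefined) \<in> polytope lam} = p x n y"
  proof (rule measure_eq_of_nn_integral[where P = "\<lambda>z. chain D 2 n ?G (z(n := y))"])
    show "Measurable.pred (Pi\<^sub>M {2..<n} (\<lambda>_. lborel)) (\<lambda>z. chain D 2 n ?G (z(n := y)))"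
      using n by (intro measurable_chain_upd) auto
    show "(\<integral>\<^sup>+z. indicator {z. chain D 2 n ?G (z(n := y))} z \<partial>Pi\<^sub>M {2..<n} (\<lambda>_. lborel)) = ennreal (p x n y)"
      unfolding p using nn_integral_chain[OF _ _ indicator_start_integrable[OF x] _ y, of "1 \<in> D" 2 n D] n x
      by (simp add: indicator_def)
    show "0 \<le> p x n y" using p_nonneg[OF x _ y] n by simp
    fix z :: "nat \<Rightarrow> real"
    have "chain D 2 n ?G (\<lambda>i. if i = 1 then x else if i = n then y else if i \<in> {2..<n} then z i else undefined)
        = chain D 2 n ?G (z(n := y))"
      using n by (intro chain_cong) auto
    then show "z \<in> {z \<in> {2..<n} \<rightarrow>\<^sub>E UNIV.
        (\<lambda>i. if i = 1 then x else if i = n then y else if i \<in> {2..<n} then z i else undefined) \<in> polytope lam} \<longleftrightarrow>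
      z \<in> space (Pi\<^sub>M {2..<n} (\<lambda>_. lborel)) \<and> chain D 2 n ?G (z(n := y))"
      using polytope_chain[of lam] n D x chain_first[of n D]
      by (auto simp: space_PiM PiE_iff extensional_def)
  qed
  then show ?thesis by (simp add: dens_joint_def n Let_def)
qed

lemma dens_first_eq:
  assumes x: "x \<in> {0..1}"
  shows "dens_first lam x = integral {0..1} (p x n) / vol_poly lam"
proof -
  let ?G = "if 1 \<in> D then {0..x} else {x..1}"
  have "measure (Pi\<^sub>M {2..n} (\<lambda>_. lborel)) {z \<in> {2..n} \<rightarrow>\<^sub>E UNIV.
      (\<lambda>i. if i = 1 then x else if i \<in> {2..n} then z i else undefined) \<in> polytope lam} = integral {0..1} (p x n)"
  proof (rule measure_eq_of_nn_integral[where P = "\<lambda>z. chain D 2 n ?G z"])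
    show "Measurable.pred (Pi\<^sub>M {2..n} (\<lambda>_. lborel)) (\<lambda>z. chain D 2 n ?G z)"
      using n by (intro measurable_chain) auto
    show "(\<integral>\<^sup>+z. indicator {z. chain D 2 n ?G z} z \<partial>Pi\<^sub>M {2..n} (\<lambda>_. lborel)) = ennreal (integral {0..1} (p x n))"
      unfolding p using n x by (intro nn_integral_chain_total indicator_start_integrable) auto
    show "0 \<le> integral {0..1} (p x n)"
      using n p_nonneg[OF x] trajectory_integrable[OF trajectory_p[OF x]] by (intro integral_nonneg) auto
    fix z :: "nat \<Rightarrow> real"
    have "chain D 2 n ?G (\<lambda>i. if i = 1 then x else if i \<in> {2..n} then z i else undefined)
        = chain D 2 n ?G z"
      using n by (intro chain_cong) auto
    then show "z \<in> {z \<in> {2..n} \<rightarrow>\<^sub>E UNIV.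
        (\<lambda>i. if i = 1 then x else if i \<in> {2..n} then z i else undefined) \<in> polytope lam} \<longleftrightarrow>
      z \<in> space (Pi\<^sub>M {2..n} (\<lambda>_. lborel)) \<and> chain D 2 n ?G z"
      using polytope_chain[of lam] n D x chain_first[of n D]
      by (auto simp: space_PiM PiE_iff extensional_def)
  qed
  then show ?thesis by (simp add: dens_first_def n Let_def)
qed

text \<open>Integrating the enclosure of \<open>p x n\<close> puts the first density
  \<open>P / S\<close> between \<open>m\<close> and \<open>M\<close> as well. The difference of
  densities is thus at most \<open>\<tau>\<close> times the product of the marginal densities, each
  of which is bounded by the length of an end run.\<close>

lemma density_difference_bound:
  assumes x: "x \<in> {0..1}" and y: "y \<in> {0..1}" and vol: "vol_poly lam \<noteq> 0"
    and osc: "ratio_osc (p x) q \<tau> n" and \<tau>: "0 \<le> \<tau>"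
    and first: "1 \<le> u" "sign_change D u" "\<And>i. 1 \<le> i \<Longrightarrow> i < u \<Longrightarrow> \<not> sign_change D i" "real (Suc u) \<le> A" "Suc (Suc u) \<le> n"
    and last: "1 \<le> w" "sign_change D w" "\<And>i. w < i \<Longrightarrow> Suc i < n \<Longrightarrow> \<not> sign_change D i" "real (n - w) \<le> A" "Suc w < n"
  shows "\<bar>dens_joint lam x y - dens_first lam x * dens_last lam y\<bar> \<le> \<tau> * A\<^sup>2"
proof -
  define S P where "S = integral {0..1} (q n)" and "P = integral {0..1} (p x n)"
  have iq: "q n integrable_on {0..1}" and ip: "p x n integrable_on {0..1}"
    using trajectory_integrable[OF trajectory_q, of n] trajectory_integrable[OF trajectory_p[OF x], of n] n by auto
  have qn: "0 \<le> q n y" using q_nonneg[OF _ y] n by simp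
  have "0 \<le> S" unfolding S_def using iq q_nonneg n by (intro integral_nonneg) auto
  then have S: "S > 0" using vol by (simp add: vol_poly_eq S_def)
  obtain m M where m: "0 \<le> m" and Mm: "M - m \<le> \<tau> * m"
    and b: "\<And>y. y \<in> {0..1} \<Longrightarrow> m * q n y \<le> p x n y \<and> p x n y \<le> M * q n y"
    using osc by (auto simp: ratio_osc_def)
  have P1: "m * S \<le> P" and P2: "P \<le> M * S"
    using b iq ip integrable_on_mult_right[OF iq] integral_le[of "\<lambda>y. m * q n y" "{0..1}" "p x n"] integral_le[of "p x n" "{0..1}" "\<lambda>y. M * q n y"]
    by (auto simp: S_def P_def)
  have q2: "trajectory D 2 q" using trajectory_shift[OF trajectory_q] by simp
  \<comment> \<open>The bound just after the first run, at state \<open>u + 2\<close>, is carried on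
    to state \<open>n\<close>.\<close>
  have first': "1 * p x n t \<le> real (Suc u) * q n t" if t: "t \<in> {0..1}" for t
  proof (rule trajectory_le[OF trajectory_p[OF x] q2 _ _ first(5) t])
    show "1 * p x (Suc (Suc u)) t \<le> real (Suc u) * q (Suc (Suc u)) t" if "t \<in> {0..1}" for t
      unfolding mult_1
      by (rule first_run_bound[OF trajectory_p[OF x] trajectory_q _ _ first(1,2,3) that]) (auto simp: p q)
  qed simp
  have "P \<le> integral {0..1} (\<lambda>t. real (Suc u) * q n t)"
    unfolding P_def using first' iq ip by (intro integral_le integrable_on_mult_right) auto
  then have "P \<le> real (Suc u) * S" by (simp add: S_def)
  also have "\<dots> \<le> A * S" using first(4) S by (intro mult_right_mono) auto
  finally have PA: "P / S \<le> A" using S by (simp add: field_simps)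
  have "q n y \<le> real (n - w) * S"
    unfolding S_def using last by (intro last_run_bound[OF trajectory_q _ _ _ q_nonneg _ y]) auto
  also have "\<dots> \<le> A * S" using last(4) S by (intro mult_right_mono) auto
  finally have qA: "q n y / S \<le> A" using S by (simp add: field_simps)
  have r: "m \<le> P / S" "P / S \<le> M" using P1 P2 S by (auto simp: field_simps)
  have "\<bar>p x n y - P / S * q n y\<bar> \<le> (M - m) * q n y"
    using b[OF y] mult_right_mono[OF r(1) qn] mult_right_mono[OF r(2) qn]
    by (simp add: abs_le_iff left_diff_distrib)
  also have "\<dots> \<le> (\<tau> * (P / S)) * q n y"
    using Mm mult_left_mono[OF r(1) \<tau>] qn by (intro mult_right_mono) auto
  finally have "\<bar>p x n y - P / S * q n y\<bar> / S \<le> \<tau> * (P / S) * q n y / S"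
    using S by (intro divide_right_mono) auto
  also have "\<dots> = \<tau> * ((P / S) * (q n y / S))" by simp
  also have "\<dots> \<le> \<tau> * (A * A)"
    using PA qA r(1) m qn S \<tau> by (intro mult_left_mono mult_mono) auto
  finally have "\<bar>p x n y - P / S * q n y\<bar> / S \<le> \<tau> * A\<^sup>2" by (simp add: power2_eq_square)
  moreover have "\<bar>p x n y - P / S * q n y\<bar> / S = \<bar>p x n y / S - P / S * (q n y / S)\<bar>"
    using S abs_divide[of "p x n y - P / S * q n y" S] by (simp add: diff_divide_distrib)
  ultimately show ?thesis
    using dens_joint_eq[OF x y] dens_first_eq[OF x] dens_last_eq[OF y]
    by (simp add: vol_poly_eq S_def P_def)
qed

text \<open>The start of \<open>p x\<close> is what step 1 makes of a point mass at
  \<open>x\<close>, and it is monotone like the result of any step.\<close>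

lemma monotone_dir_p: "x \<in> {0..1} \<Longrightarrow> monotone_dir (1 \<in> D) (p x 2)"
  by (auto simp: monotone_dir_def p monotone_on_def indicator_def)

end

section \<open>Runs of a composition\<close>

text \<open>Cells \<open>a\<close> to \<open>b\<close> are joined by the steps \<open>a\<close> to
  \<open>b - 1\<close>, so only sign changes up to \<open>b - 2\<close> count.\<close>

lemma monotone_seg_if_no_sign_change:
  assumes "1 \<le> a" "a + 1 \<le> b" "b \<le> sum_list lam"
    and "\<And>i. a \<le> i \<Longrightarrow> Suc i < b \<Longrightarrow> \<not> sign_change (descents lam) i"
  shows "monotone_seg lam a b"
proof -
  have "i \<in> descents lam \<longleftrightarrow> a \<in> descents lam" if "i \<in> {a..<b}" for i
    using no_sign_change_const[of a "b - 1" "descents lam" i] assms that by auto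
  then show ?thesis using assms(1-3) unfolding monotone_seg_def by blast
qed

lemma no_sign_change_if_monotone_seg:
  assumes "monotone_seg lam a b" "a \<le> i" "Suc i < b"
  shows "\<not> sign_change (descents lam) i"
proof -
  have "i \<in> {a..<b}" "Suc i \<in> {a..<b}" using assms(2,3) by auto
  then show ?thesis using assms(1) unfolding monotone_seg_def sign_change_def by blast
qed

text \<open>The first sign change ends the first run, at cell \<open>u + 1\<close>. It exists
  because otherwise that run would have length \<open>n\<close>, which exceeds
  \<open>A\<close>.\<close>

lemma first_run_sign_change:
  assumes A: "runs_at_le lam 1 A" and n: "sum_list lam = n" "2 \<le> n" "A < real n"
  obtains u where "1 \<le> u" "Suc u < n" "real (Suc u) \<le> A" "sign_change (descents lam) u"
    "\<And>i. 1 \<le> i \<Longrightarrow> i < u \<Longrightarrow> \<not> sign_change (descents lam) i"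
proof -
  \<comment> \<open>The disjunct \<open>n \<le> Suc u\<close> guarantees that a least
    \<open>u\<close> exists; the length bound rules it out afterwards.\<close>
  define Q where "Q u \<longleftrightarrow> 1 \<le> u \<and> (n \<le> Suc u \<or> sign_change (descents lam) u)" for u
  define u where "u = (LEAST u. Q u)"
  have "Q (n - 1)" using n by (simp add: Q_def)
  then have Qu: "Q u" and un: "u \<le> n - 1" unfolding u_def by (auto intro: LeastI Least_le)
  have no: "\<not> sign_change (descents lam) i" if "1 \<le> i" "i < u" for i
    using not_less_Least[of i Q] that by (auto simp: u_def Q_def)
  have u1: "1 \<le> u" using Qu by (simp add: Q_def)
  have "is_run lam 1 (Suc u)"
    unfolding is_run_def
  proof (intro conjI allI impI)
    show "monotone_seg lam 1 (Suc u)"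
      using u1 un n no by (intro monotone_seg_if_no_sign_change) auto
    fix a b assume ab: "a \<le> 1 \<and> Suc u \<le> b \<and> monotone_seg lam a b"
    then have "1 \<le> a" "b \<le> n" by (auto simp: monotone_seg_def n(1))
    then show "a = 1" using ab by simp
    show "b = Suc u"
    proof (rule ccontr)
      assume "b \<noteq> Suc u"
      then have "Suc u < b" using ab by simp
      then have "\<not> sign_change (descents lam) u"
        using ab \<open>a = 1\<close> u1 by (intro no_sign_change_if_monotone_seg) auto
      then show False using Qu \<open>Suc u < b\<close> \<open>b \<le> n\<close> by (simp add: Q_def)
    qed
  qed
  then have le: "real (Suc u) \<le> A" using A u1 by (fastforce simp: runs_at_le_def)
  then have "Suc u < n" using n(3) by linarith
  then show thesis using that[of u] u1 le no Qu by (simp add: Q_def)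
qed

text \<open>The last sign change precedes the last run, which begins at cell \<open>w + 1\<close>
  and has length \<open>n - w\<close>.\<close>

lemma last_run_sign_change:
  assumes A: "runs_at_le lam n A" and n: "sum_list lam = n" "2 \<le> n" "A < real n"
  obtains w where "1 \<le> w" "Suc w < n" "real (n - w) \<le> A" "sign_change (descents lam) w"
    "\<And>i. w < i \<Longrightarrow> Suc i < n \<Longrightarrow> \<not> sign_change (descents lam) i"
proof -
  \<comment> \<open>The value 0 stands for the absence of a sign change; it would give a last run of
    length \<open>n > A\<close>.\<close>
  define Q where "Q w \<longleftrightarrow> w = 0 \<or> Suc w < n \<and> sign_change (descents lam) w" for w
  define w where "w = (GREATEST w. Q w)"
  have bound: "\<forall>w. Q w \<longrightarrow> w \<le> n" by (auto simp: Q_def)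
  have Qw: "Q w" unfolding w_def
    by (rule GreatestI_nat[of Q 0 n]) (use bound in \<open>auto simp: Q_def\<close>)
  have no: "\<not> sign_change (descents lam) i" if "w < i" "Suc i < n" for i
  proof
    assume "sign_change (descents lam) i"
    then have "Q i" using that by (simp add: Q_def)
    then show False using Greatest_le_nat[of Q i n] bound that by (simp add: w_def)
  qed
  have wn: "Suc w < n" using Qw n(2) by (auto simp: Q_def)
  have "is_run lam (Suc w) n"
    unfolding is_run_def
  proof (intro conjI allI impI)
    show "monotone_seg lam (Suc w) n"
      using wn n no by (intro monotone_seg_if_no_sign_change) auto
    fix a b assume ab: "a \<le> Suc w \<and> n \<le> b \<and> monotone_seg lam a b"
    then have "1 \<le> a" "b \<le> n" by (auto simp: monotone_seg_def n(1))
    then show "b = n" using ab by simp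
    show "a = Suc w"
    proof (rule ccontr)
      assume "a \<noteq> Suc w"
      then have "a \<le> w" using ab by simp
      then have "\<not> sign_change (descents lam) w"
        using ab \<open>b = n\<close> wn by (intro no_sign_change_if_monotone_seg[of lam a b]) auto
      then show False using Qw \<open>1 \<le> a\<close> \<open>a \<le> w\<close> by (simp add: Q_def)
    qed
  qed
  moreover have "Suc w \<le> n" using wn by simp
  ultimately have "real (n - Suc w + 1) \<le> A" using A unfolding runs_at_le_def by blast
  moreover have "n - Suc w + 1 = n - w" using wn by simp
  ultimately have le: "real (n - w) \<le> A" by simp
  then have "1 \<le> w" using n(3) by (cases w) auto
  then show thesis using that[of w] wn le no Qw by (simp add: Q_def)
qed

section \<open>Uniform asymptotic independence of the two end coordinates\<close>

theorem mainTheorem2: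
  fixes \<epsilon> A :: real
  assumes "\<epsilon> > 0" and "A \<ge> 0"
  shows "\<exists>n0::nat. \<forall>(n::nat) lam. n \<ge> n0 \<longrightarrow> is_composition lam n \<longrightarrow>
           runs_at_le lam 1 A \<longrightarrow> runs_at_le lam n A \<longrightarrow>
           (SUP p\<in>{0..1::real} \<times> {0..1::real}.
              \<bar>dens_joint lam (fst p) (snd p) - dens_first lam (fst p) * dens_last lam (snd p)\<bar>) < \<epsilon>"
proof -
  \<comment> \<open>The 1 keeps the denominator positive for \<open>A = 0\<close>; the 2 leaves room
    for a strict inequality after taking the supremum.\<close>
  define \<tau> where "\<tau> = \<epsilon> / (2 * (A\<^sup>2 + 1))"
  have A2: "A\<^sup>2 + 1 > 0" by (simp add: add_nonneg_pos)
  have \<tau>: "\<tau> > 0" using assms(1) A2 by (simp add: \<tau>_def)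
  have \<tau>A: "\<tau> * A\<^sup>2 \<le> \<epsilon> / 2"
  proof -
    have "\<tau> * A\<^sup>2 \<le> \<tau> * (A\<^sup>2 + 1)" using \<tau> by simp
    also have "\<dots> = \<epsilon> / 2" using A2 unfolding \<tau>_def by (metis less_irrefl nonzero_mult_divide_mult_cancel_right times_divide_eq_left)
    finally show ?thesis .
  qed
  obtain n1 where n1: "\<And>n D p q. \<lbrakk>n1 \<le> n; trajectory D 2 p; trajectory D 1 q;
     \<forall>y\<in>{0..1}. 0 \<le> p 2 y; \<forall>y\<in>{0..1}. 0 \<le> q 1 y; monotone_dir (1 \<in> D) (p 2);
     \<exists>u\<ge>1. real (Suc u) \<le> A \<and> sign_change D u;
     \<exists>w. real (n - w) \<le> A \<and> Suc w < n \<and> sign_change D w;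
     \<exists>y\<in>{0..1}. q n y \<noteq> 0\<rbrakk> \<Longrightarrow> ratio_osc p q \<tau> n"
    using ratio_osc_small[OF \<tau>, of A] by blast
  \<comment> \<open>With \<open>A < n\<close> neither end run can be the whole composition.\<close>
  obtain n2 :: nat where n2: "A < n2" using reals_Archimedean2 by blast
  show ?thesis
  proof (intro exI allI impI)
    fix n lam
    assume n: "max (max n1 n2) 3 \<le> n" and lam: "is_composition lam n"
      and first: "runs_at_le lam 1 A" and last: "runs_at_le lam n A"
    have sn: "sum_list lam = n" and n3: "3 \<le> n" and An: "A < real n"
      using lam n n2 by (auto simp: is_composition_def)
    define D where "D = descents lam"
    define q where "q = evolution D 1 (indicator {0..1})"
    define p where "p x = evolution D 2 (indicator (if 1 \<in> D then {0..x} else {x..1}))" for x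
    note setup_facts = sn n3 D_def q_def p_def
    obtain u where u: "1 \<le> u" "Suc u < n" "real (Suc u) \<le> A" "sign_change D u"
      "\<And>i. 1 \<le> i \<Longrightarrow> i < u \<Longrightarrow> \<not> sign_change D i"
      using first_run_sign_change[OF first sn _ An] n3 unfolding D_def by auto
    obtain w where w: "1 \<le> w" "Suc w < n" "real (n - w) \<le> A" "sign_change D w"
      "\<And>i. w < i \<Longrightarrow> Suc i < n \<Longrightarrow> \<not> sign_change D i"
      using last_run_sign_change[OF last sn _ An] n3 unfolding D_def by auto
    have bound: "\<bar>dens_joint lam x y - dens_first lam x * dens_last lam y\<bar> \<le> \<epsilon> / 2"
      if x: "x \<in> {0..1}" and y: "y \<in> {0..1}" for x y
    proof (cases "vol_poly lam = 0")
      \<comment> \<open>Division by zero makes all three densities 0.\<close>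
      case True
      then show ?thesis
        using assms(1) by (simp add: dens_joint_def dens_first_def dens_last_def Let_def)
    next
      case False
      have "\<exists>y\<in>{0..1}. q n y \<noteq> 0"
      proof (rule ccontr)
        assume "\<not> ?thesis"
        then have "integral {0..1} (q n) = integral {0..1} (\<lambda>_::real. 0)" by (intro integral_cong) auto
        then show False using False vol_poly_eq[OF setup_facts] by simp
      qed
      moreover have "\<exists>w. real (n - w) \<le> A \<and> Suc w < n \<and> sign_change D w"
        using w(2,3,4) by blast
      ultimately have "ratio_osc (p x) q \<tau> n"
        using n u trajectory_p[OF setup_facts x] trajectory_q[OF setup_facts]
          p_nonneg[OF setup_facts x] q_nonneg[OF setup_facts] monotone_dir_p[OF setup_facts x]
        by (intro n1[of n D]) auto
      from density_difference_bound[OF setup_facts x y False this _ u(1,4,5,3) _ w(1,4,5,3,2)]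
      show ?thesis using \<tau> \<tau>A u(2) by simp
    qed
    have "(SUP p\<in>{0..1::real} \<times> {0..1::real}.
        \<bar>dens_joint lam (fst p) (snd p) - dens_first lam (fst p) * dens_last lam (snd p)\<bar>) \<le> \<epsilon> / 2"
      by (rule cSUP_least) (use bound in auto)
    then show "(SUP p\<in>{0..1::real} \<times> {0..1::real}.
        \<bar>dens_joint lam (fst p) (snd p) - dens_first lam (fst p) * dens_last lam (snd p)\<bar>) < \<epsilon>"
      using assms(1) by linarith
  qed
qed

end
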